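(* Let $(\mathbf{x}^k)_{k\ge 1}$ be the sequence generated by Adam (as defined in the context). Assume: (i) $\mathbb{E}[\mathbf{g}^k\mid\mathcal{F}^k]=\nabla f(\mathbf{x}^k)$ for all $k\ge1$, and there exists $M>0$ such that $\|\mathbf{g}^k\|\le M$ almost surely for all $k\ge1$; (ii) $f$ is bounded below, with $f^*:=\inf_{\mathbf{x}\in\mathbb{R}^d} f(\mathbf{x})>-\infty$, and $f$ is $L$-smooth for some $L>0$, i.e. $\|\nabla f(\mathbf{x})-\nabla f(\mathbf{y})\|\le L\|\mathbf{x}-\mathbf{y}\|$ for all $\mathbf{x},\mathbf{y}\in\mathbb{R}^d$; (iii) (Polyak–Łojasiewicz condition) there exists $v>0$ such that $\|\nabla f(\mathbf{x})\|^2\ge 2v\,(f(\mathbf{x})-f^* )$ for all $\mathbf{x}\in\mathbb{R}^d$; (iv) $\eta_k=\dfrac{\sqrt{M^2+\epsilon}}{(1-\beta)v}\cdot\dfrac{1}{k+1}$ for all $k\ge1$, and $\theta_k=1-1/k^p$ for all $k\ge1$, for some $p>0$. Then, as $K\to\infty$, $$\mathbb{E}\big[f(\mathbf{x}^{K+1})\big]-f^*\le\begin{cases}O(1/K)+O(1/K^p), & 0<p<2,\\ O(1/K)+O(\ln K/K^2), & p=2,\\ O(1/K)+O(1/K^2), & p>2.\end{cases}$$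
   Context: Setting: $f:\mathbb{R}^d\to\mathbb{R}$ is differentiable, $f(\mathbf{x})=\mathbb{E}_{\xi\sim\mathbb{P}}[\ell(\mathbf{x};\xi)]$. All vector operations (powers, square roots, products, quotients, adding a scalar) are element-wise; $\|\cdot\|$ is the Euclidean norm. Adam: given deterministic parameters $\eta_k>0$ (step size), $\epsilon>0$, $0\le\beta_k\le\beta<1$, $\theta_k\in[0,1)$ for $k\ge1$, initialize $\mathbf{m}^0=\mathbf{0}$, $\mathbf{v}^0=\mathbf{0}$, $\mathbf{x}^1\in\mathbb{R}^d$ (deterministic). For $k=1,2,\dots$: sample the stochastic gradient $\mathbf{g}^k=\nabla\ell(\mathbf{x}^k;\xi^k)$, where $\xi^k$ is the random data sample drawn at iteration $k$, and set $$\mathbf{m}^k=\beta_k\mathbf{m}^{k-1}+(1-\beta_k)\mathbf{g}^k,\quad \mathbf{v}^k=\theta_k\mathbf{v}^{k-1}+(1-\theta_k)(\mathbf{g}^k)^2,\quad \mathbf{x}^{k+1}=\mathbf{x}^k-\eta_k\frac{\mathbf{m}^k}{\sqrt{\mathbf{v}^k+\epsilon}}.$$ $\mathcal{F}^k:=\sigma(\mathbf{x}^1,\dots,\mathbf{x}^k)$. The scalar $v$ in the Polyak–Łojasiewicz condition is unrelated to the vectors $\mathbf{v}^k$. The constants hidden in $O(\cdot)$ do not depend on $K$. *)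

theory Defs
  imports "HOL-Probability.Probability" "HOL-Library.Landau_Symbols"
begin

(* The Adam recursion for one realisation g of the stochastic gradients. All vector operations are
   element-wise. Index 0 carries only the initial values of m and v: x 0, g 0, \<eta> 0, \<beta> 0 and \<theta> 0
   do not occur. *)
definition adam ::
  "(nat \<Rightarrow> real) \<Rightarrow> real \<Rightarrow> (nat \<Rightarrow> real) \<Rightarrow> (nat \<Rightarrow> real) \<Rightarrow> real ^ 'n \<Rightarrow> (nat \<Rightarrow> real ^ 'n) \<Rightarrow>
    (nat \<Rightarrow> real ^ 'n) \<Rightarrow> (nat \<Rightarrow> real ^ 'n) \<Rightarrow> (nat \<Rightarrow> real ^ 'n) \<Rightarrow> bool" where
  "adam \<eta> \<epsilon> \<beta> \<theta> x1 g m v x \<longleftrightarrow>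
     m 0 = 0 \<and> v 0 = 0 \<and> x 1 = x1 \<and>
     (\<forall>k\<ge>1.
        m k = \<beta> k *\<^sub>R m (k - 1) + (1 - \<beta> k) *\<^sub>R g k \<and>
        v k = \<theta> k *\<^sub>R v (k - 1) + (1 - \<theta> k) *\<^sub>R (\<chi> i. (g k $ i)\<^sup>2) \<and>
        x (k + 1) = x k - \<eta> k *\<^sub>R (\<chi> i. m k $ i / sqrt (v k $ i + \<epsilon>)))"

definition history :: "'w measure \<Rightarrow> (nat \<Rightarrow> 'w \<Rightarrow> 'a::topological_space) \<Rightarrow> nat \<Rightarrow> 'w measure" where
  "history \<Omega> x k =
     sigma (space \<Omega>) {x j -` A \<inter> space \<Omega> | j A. j \<in> {1..k} \<and> A \<in> sets borel}"

(* The library's conditional expectation is real-valued; that of a random vector is taken in each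
   coordinate. *)
definition vec_cond_exp ::
  "'w measure \<Rightarrow> 'w measure \<Rightarrow> ('w \<Rightarrow> real ^ 'n) \<Rightarrow> 'w \<Rightarrow> real ^ 'n" where
  "vec_cond_exp \<Omega> F X \<omega> = (\<chi> i. real_cond_exp \<Omega> F (\<lambda>\<omega>'. X \<omega>' $ i) \<omega>)"

end

theory Submission
  imports Defs
begin

text \<open>
  Write $s_k = \sqrt{v^k + \epsilon}$, $d^k = m^k / s_k$ and $u_k = \nabla f(x^k)$ (coordinatewise).
  Smoothness gives $E f(x^{k+1}) \le E f(x^k) - \eta_k E\langle u_k, d^k\rangle + O(1/k^2)$, so one needs
  a lower bound for $E\langle u_k, d^k\rangle$. The vector $v^{k-1}$ need not be measurable with respect to
  $F^k = \sigma(x^1, \dots, x^k)$, so $s_{k-1}$ cannot be pulled out of a conditional expectation given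
  $F^k$. Instead put $A_k = E[s_{k-1} | F^k]$ and $B_k = E[s_{k-1} | F^{k+1}]$. Because $d^k$ is
  $F^{k+1}$-measurable, $E[u_k d^k]$ equals $E[(u_k / A_k) s_{k-1} d^k]$ up to
  $E[(u_k / A_k)(A_k - B_k) d^k]$; and $s_{k-1} d^k$ is within $O(k^{-p})$ of $m^k$, which produces
  $\beta_k E[u_k d^{k-1}] + (1 - \beta_k) E[u_k^2 / A_k]$. By Young's inequality the error costs a small
  multiple of $E u_k^2$ plus a multiple of $E(A_k - B_k)^2 = E B_k^2 - E A_k^2$, and this telescopes,
  because $B_k$ is within $O(k^{-p})$ of $A_{k+1}$. A bounded telescoping term multiplied by the step
  size $O(1/k)$ contributes only $O(1/k^2)$ per step, and the Polyak-Lojasiewicz inequality gives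
  contraction by the factor $1 - (3/2)/(k+1)$, hence the rate $O(K^{-q})$ with $q = \min(p, 1)$. This is
  the claim: for $p \ge 1$ the term $O(1/K)$ dominates.
\<close>

subsection \<open>Real recursions\<close>

text \<open>The ratio \<open>(k + 1) / k\<close> is at least 1, so raising it to a power
  \<open>q \<le> 1\<close> does not increase it. In the induction for
  \<open>perturbed_contraction_rate\<close> this is the price of passing from \<open>k\<close> to
  \<open>k + 1\<close>.\<close>

lemma Suc_powr_neg_ge:
  fixes q :: real and k :: nat
  assumes "0 < q" "q \<le> 1" "1 \<le> k"
  shows "1 / real k powr q \<le> (1 + 1 / real k) * (1 / (real k + 1) powr q)"
proof -
  have "((real k + 1) / real k) powr q \<le> ((real k + 1) / real k) powr 1"
    using assms by (intro powr_mono) auto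
  also have "\<dots> = 1 + 1 / real k" using assms by (simp add: field_simps)
  finally have "(real k + 1) powr q / real k powr q \<le> 1 + 1 / real k"
    using assms by (simp add: powr_divide)
  then show ?thesis using assms by (simp add: field_simps)
qed

text \<open>The contraction beats the price of the index shift:
  \<open>(1 - (3 / 2) / (k + 1)) * (1 + 1 / k) = 1 - (1 / 2) / k\<close>, and the margin
  \<open>(1 / 2) / k\<close> absorbs the forcing term. The differences of \<open>W\<close> are
  summed by parts, which is cheap because their weights \<open>c1 / (k + 1)\<close> vary
  slowly.\<close>

lemma perturbed_contraction_rate:
  fixes \<delta> W :: "nat \<Rightarrow> real"
  assumes q: "0 < q" "q \<le> 1" and c: "0 \<le> c1"
    and W: "\<And>k. 1 \<le> k \<Longrightarrow> \<bar>W k\<bar> \<le> B"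
    and step: "\<And>k. 1 \<le> k \<Longrightarrow> \<delta> (k + 1) \<le> (1 - (3 / 2) / (real k + 1)) * \<delta> k
        + c1 / (real k + 1) * (W k - W (k + 1)) + c2 / (real k + 1) * (1 / (real k + 1) powr q)"
  shows "\<exists>C\<ge>0. \<forall>k\<ge>1. \<delta> k \<le> C / real k powr q"
proof -
  have B: "0 \<le> B" using W[of 1] by simp
  \<comment> \<open>\<open>W\<close> is bounded but need not decay: moving it into \<open>\<Psi>\<close> leaves only an error of order \<open>1 / k\<^sup>2\<close>.\<close>
  define \<Psi> where "\<Psi> k = \<delta> k + c1 * (W k + B) / (real k + 1)" for k
  \<comment> \<open>\<open>3 * c1 * B\<close> is \<open>3 / 2\<close> times \<open>c1\<close> times
    the bound \<open>2 * B\<close> on \<open>W k + B\<close>; the modulus of \<open>c2\<close>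
    allows either sign.\<close>
  define c3 where "c3 = 3 * c1 * B + \<bar>c2\<bar>"
  \<comment> \<open>The first entry starts the induction; the second lets the margin
    \<open>(C / 2) / k\<close> cover \<open>c3 / (k + 1)\<close>.\<close>
  define C where "C = max \<bar>\<Psi> 1\<bar> (2 * c3)"
  have Psi_step: "\<Psi> (k + 1) \<le> (1 - (3 / 2) / (real k + 1)) * \<Psi> k + c3 / (real k + 1) * (1 / (real k + 1) powr q)"
    if k: "1 \<le> k" for k
  proof -
    have r: "1 / (real k + 1) \<le> 1 / (real k + 1) powr q"
      using powr_mono[of q 1 "real k + 1"] q by (intro divide_left_mono) auto
    \<comment> \<open>Adding \<open>B\<close> makes the numerators nonnegative: the denominator may
      then be lowered from \<open>k + 2\<close> to \<open>k + 1\<close>, and \<open>\<Psi>\<close>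
      dominates \<open>\<delta>\<close> at the end.\<close>
    have W1: "0 \<le> W (k + 1) + B" "0 \<le> W k + B" "W k + B \<le> 2 * B" using W[of "k + 1"] W[of k] k by auto
    have 1: "c1 * (W (k + 1) + B) / (real (k + 1) + 1) \<le> c1 * (W (k + 1) + B) / (real k + 1)"
      using c W1 by (intro divide_left_mono) auto
    have "(3 / 2) / (real k + 1) * (c1 * (W k + B) / (real k + 1))
        \<le> (3 / 2) / (real k + 1) * (c1 * (2 * B) * (1 / (real k + 1)))"
    proof -
      have "c1 * (W k + B) \<le> c1 * (2 * B)" using c W1 by (intro mult_left_mono) auto
      then show ?thesis by (intro mult_left_mono) (auto simp: divide_simps)
    qed
    also have "\<dots> \<le> (3 / 2) / (real k + 1) * (c1 * (2 * B) * (1 / (real k + 1) powr q))"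
      using r c B by (intro mult_left_mono) auto
    also have "\<dots> = (3 * c1 * B) / (real k + 1) * (1 / (real k + 1) powr q)"
      by (simp add: divide_simps)
    finally have 2: "(3 / 2) / (real k + 1) * (c1 * (W k + B) / (real k + 1))
        \<le> (3 * c1 * B) / (real k + 1) * (1 / (real k + 1) powr q)" .
    have 3: "c2 / (real k + 1) * (1 / (real k + 1) powr q) \<le> \<bar>c2\<bar> / (real k + 1) * (1 / (real k + 1) powr q)"
      by (intro mult_right_mono divide_right_mono) auto
    have 4: "c3 / (real k + 1) * (1 / (real k + 1) powr q) = (3 * c1 * B) / (real k + 1) * (1 / (real k + 1) powr q)
       + \<bar>c2\<bar> / (real k + 1) * (1 / (real k + 1) powr q)"
      by (simp add: c3_def add_divide_distrib distrib_right)
    have 5: "c1 / (real k + 1) * (W k - W (k + 1)) + c1 * (W (k + 1) + B) / (real k + 1)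
       = c1 * (W k + B) / (real k + 1)" by (simp add: add_divide_distrib diff_divide_distrib algebra_simps)
    define r t y where "r = (3 / 2) / (real k + 1)" and "t = c1 * (W k + B) / (real k + 1)"
      and "y = 1 / (real k + 1) powr q"
    have "\<Psi> (k + 1) \<le> \<delta> (k + 1) + c1 * (W (k + 1) + B) / (real k + 1)"
      using 1 unfolding \<Psi>_def by simp
    also have "\<dots> \<le> (1 - r) * \<delta> k + t + c2 / (real k + 1) * y"
      using step[OF k] 5 unfolding r_def t_def y_def by simp
    also have "\<dots> = (1 - r) * \<Psi> k + r * t + c2 / (real k + 1) * y"
      unfolding \<Psi>_def t_def[symmetric] by (simp add: algebra_simps)
    also have "\<dots> \<le> (1 - r) * \<Psi> k + c3 / (real k + 1) * y"
      using 2 3 4 unfolding r_def t_def y_def by simp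
    finally show ?thesis unfolding r_def y_def .
  qed
  have Psi: "\<Psi> k \<le> C * (1 / real k powr q)" if "1 \<le> k" for k
    using that
  proof (induction k rule: nat_induct_at_least)
    case base
    then show ?case by (auto simp: C_def)
  next
    case (Suc k)
    define z where "z = 1 / (real k + 1) powr q"
    have z: "0 \<le> z" by (simp add: z_def)
    have C: "0 \<le> C" "2 * c3 \<le> C" by (auto simp: C_def)
    have k: "1 \<le> real k" using Suc by simp
    have "\<Psi> (k + 1) \<le> (1 - (3 / 2) / (real k + 1)) * \<Psi> k + c3 / (real k + 1) * z"
      using Psi_step Suc z_def by simp
    also have "\<dots> \<le> (1 - (3 / 2) / (real k + 1)) * (C * ((1 + 1 / real k) * z)) + c3 / (real k + 1) * z"
    proof (intro add_right_mono mult_left_mono)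
      show "\<Psi> k \<le> C * ((1 + 1 / real k) * z)"
        using Suc Suc_powr_neg_ge[OF q Suc.hyps] C unfolding z_def
        by (meson mult_left_mono order_trans)
    qed (use k in \<open>auto simp: divide_simps\<close>)
    also have "\<dots> = (C * ((1 - (3 / 2) / (real k + 1)) * (1 + 1 / real k)) + c3 / (real k + 1)) * z"
      by (simp add: distrib_right)
    also have "(1 - (3 / 2) / (real k + 1)) * (1 + 1 / real k) = 1 - (1 / 2) / real k"
      using k by (simp add: divide_simps)
    also have "(C * (1 - (1 / 2) / real k) + c3 / (real k + 1)) * z \<le> C * z"
    proof (intro mult_right_mono z)
      have "c3 / (real k + 1) \<le> (C / 2) / (real k + 1)" using C by (intro divide_right_mono) auto
      also have "\<dots> \<le> (C / 2) / real k" using C k by (intro divide_left_mono) auto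
      finally show "C * (1 - (1 / 2) / real k) + c3 / (real k + 1) \<le> C" by (simp add: algebra_simps)
    qed
    finally show ?case by (simp add: z_def add.commute)
  qed
  have "\<delta> k \<le> C / real k powr q" if k: "1 \<le> k" for k
  proof -
    have "0 \<le> c1 * (W k + B) / (real k + 1)" using c W[OF k] by auto
    then show ?thesis using Psi[OF k] unfolding \<Psi>_def by simp
  qed
  moreover have "0 \<le> C" by (simp add: C_def)
  ultimately show ?thesis by blast
qed

text \<open>Unrolling the momentum inequality and dropping the nonnegative contributions of earlier
  \<open>G\<close> leaves \<open>\<mu> k \<ge> c * G k - E k\<close>, where \<open>E\<close> sums
  the errors \<open>e\<close> with geometric weights. A geometric sum of telescoping differences
  again telescopes up to small terms, which reduces the claim to
  \<open>perturbed_contraction_rate\<close>.\<close>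

lemma momentum_recursion_rate:
  fixes \<delta> \<mu> G a e b :: "nat \<Rightarrow> real"
  assumes q: "0 < q" "q \<le> 1" and h: "0 \<le> h" and b: "\<And>k. 1 \<le> k \<Longrightarrow> 0 \<le> b k" "\<And>k. 1 \<le> k \<Longrightarrow> b k \<le> \<beta>" "\<beta> < 1"
    and c: "0 \<le> c" and G: "\<And>k. 0 \<le> G k" 
    and descent: "\<And>k. 1 \<le> k \<Longrightarrow> \<delta> (k + 1) \<le> \<delta> k - h / (real k + 1) * \<mu> k + C1 / (real k + 1)\<^sup>2"
    and mu0: "\<mu> 0 = 0"
    and mu: "\<And>k. 1 \<le> k \<Longrightarrow> \<mu> k \<ge> b k * \<mu> (k - 1) + c * G k - e k"
    and e: "\<And>k. 1 \<le> k \<Longrightarrow> 0 \<le> e k"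
      "\<And>k. 1 \<le> k \<Longrightarrow> e k = C2 * (1 / (real k + 1) powr q) + C3 * (a (k + 1) - a k)"
    and a: "\<And>k. 1 \<le> k \<Longrightarrow> \<bar>a k\<bar> \<le> Ba"
    and PL: "\<And>k. 1 \<le> k \<Longrightarrow> h * c * G k \<ge> 3 / 2 * \<delta> k"
  shows "\<exists>C\<ge>0. \<forall>k\<ge>1. \<delta> k \<le> C / real k powr q"
proof -
  \<comment> \<open>Discounting by the constant \<open>\<beta>\<close> rather than by
    \<open>b k\<close> lets \<open>(1 - \<beta>) * E k\<close> telescope; this is a valid bound
    because the errors are nonnegative. The start value 0 matches
    \<open>\<mu> 0 = 0\<close>.\<close>
  define E where "E = rec_nat 0 (\<lambda>k r. \<beta> * r + e (Suc k))"
  have E0: "E 0 = 0" and ES: "E (Suc k) = \<beta> * E k + e (Suc k)" for k by (simp_all add: E_def)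
  have beta: "0 \<le> \<beta>" using b(1,2)[of 1] by simp
  have Enn: "0 \<le> E k" for k
    by (induction k) (use beta e(1) in \<open>auto simp: E0 ES\<close>)
  define Be where "Be = \<bar>C2\<bar> + 2 * \<bar>C3\<bar> * Ba"
  have z1: "1 / (real k + 1) powr q \<le> 1" for k
    using q by (simp add: ge_one_powr_ge_zero)
  have eB: "e k \<le> Be" if k: "1 \<le> k" for k
  proof -
    have "C2 * (1 / (real k + 1) powr q) \<le> \<bar>C2\<bar> * 1"
      using z1[of k] by (intro mult_mono) auto
    moreover have "C3 * (a (k + 1) - a k) \<le> \<bar>C3\<bar> * \<bar>a (k + 1) - a k\<bar>"
      by (metis abs_ge_self abs_mult)
    moreover have "\<dots> \<le> \<bar>C3\<bar> * (2 * Ba)"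
      using a[of k] a[of "k + 1"] k by (intro mult_left_mono) auto
    ultimately show ?thesis unfolding e(2)[OF k] Be_def by simp
  qed
  \<comment> \<open>\<open>Be / (1 - \<beta>)\<close> is the fixed point of the map taking
    \<open>r\<close> to \<open>\<beta> * r + Be\<close>.\<close>
  have EB: "E k \<le> Be / (1 - \<beta>)" for k
  proof (induction k)
    case 0
    then show ?case using eB[of 1] e(1)[of 1] b(3) by (simp add: E0)
  next
    case (Suc k)
    have "E (Suc k) \<le> \<beta> * (Be / (1 - \<beta>)) + Be"
      unfolding ES using eB[of "Suc k"] Suc beta by (intro add_mono mult_left_mono) auto
    also have "\<dots> = Be / (1 - \<beta>)" using b(3) by (simp add: field_simps)
    finally show ?case .
  qed
  \<comment> \<open>At index 0 no inequality involving \<open>G 0\<close> is available, only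
    \<open>\<mu> 0 = 0 = - E 0\<close>; hence the guarded premise.\<close>
  have muE: "\<mu> k \<ge> - E k" if "1 \<le> k \<longrightarrow> \<mu> k \<ge> c * G k - E k" for k
    using that G[of k] c mu0 E0 by (cases k) (auto intro: order_trans[rotated])
  have mu_ge: "1 \<le> k \<longrightarrow> \<mu> k \<ge> c * G k - E k" for k
  proof (induction k)
    case (Suc k)
    have "b (Suc k) * \<mu> k \<ge> b (Suc k) * (- E k)"
      using muE[OF Suc] b by (intro mult_left_mono) auto
    moreover have "b (Suc k) * E k \<le> \<beta> * E k" using b(2)[of "Suc k"] Enn by (intro mult_right_mono) auto
    ultimately show ?case using mu[of "Suc k"] by (auto simp: ES)
  qed simp
  \<comment> \<open>chosen so that \<open>E k = W k - W (k + 1)\<close> up to \<open>O(k powr - q)\<close>, from \<open>(1 - \<beta>) E\<^sub>k = E\<^sub>k - E\<^bsub>k+1\<^esub> + e\<^bsub>k+1\<^esub>\<close>.\<close>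
  define W where "W k = (E k - C3 * a (k + 1)) / (1 - \<beta>)" for k
  have W_bound: "\<bar>W k\<bar> \<le> (Be / (1 - \<beta>) + \<bar>C3\<bar> * Ba) / (1 - \<beta>)" for k
  proof -
    have "\<bar>C3 * a (k + 1)\<bar> \<le> \<bar>C3\<bar> * Ba" unfolding abs_mult using a[of "k + 1"] by (intro mult_left_mono) auto
    then have "\<bar>E k - C3 * a (k + 1)\<bar> \<le> Be / (1 - \<beta>) + \<bar>C3\<bar> * Ba"
      using Enn[of k] EB[of k] by linarith
    then show ?thesis unfolding W_def using b(3) by (simp add: divide_right_mono)
  qed
  have EW: "E k \<le> W k - W (k + 1) + \<bar>C2\<bar> / (1 - \<beta>) * (1 / (real k + 1) powr q)" if k: "1 \<le> k" for k
  proof -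
    have m: "1 / (real (Suc k) + 1) powr q \<le> 1 / (real k + 1) powr q"
      using q by (intro divide_left_mono powr_mono2) auto
    have "C2 * (1 / (real (Suc k) + 1) powr q) \<le> \<bar>C2\<bar> * (1 / (real k + 1) powr q)"
      using m by (intro mult_mono) auto
    then have "(1 - \<beta>) * E k \<le> (E k - C3 * a (k + 1)) - (E (k + 1) - C3 * a (k + 1 + 1)) + \<bar>C2\<bar> * (1 / (real k + 1) powr q)"
      using ES[of k] e(2)[of "Suc k"] by (simp add: algebra_simps)
    then have "E k \<le> ((E k - C3 * a (k + 1)) - (E (k + 1) - C3 * a (k + 1 + 1)) + \<bar>C2\<bar> * (1 / (real k + 1) powr q)) / (1 - \<beta>)"
      using b(3) by (simp add: pos_le_divide_eq mult.commute)
    then show ?thesis unfolding W_def by (simp add: add_divide_distrib diff_divide_distrib mult.commute)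
  qed
  show ?thesis
  proof (rule perturbed_contraction_rate[OF q h W_bound])
    fix k :: nat assume k: "1 \<le> k"
    define z where "z = 1 / (real k + 1) powr q"
    have hk: "0 \<le> h / (real k + 1)" using h by simp
    have "h / (real k + 1) * \<mu> k \<ge> h / (real k + 1) * (c * G k - E k)"
      using mu_ge[of k] k by (intro mult_left_mono hk) auto
    moreover have "h / (real k + 1) * (c * G k) \<ge> (3 / 2) / (real k + 1) * \<delta> k"
      using divide_right_mono[OF PL[OF k], of "real k + 1"] by (simp add: mult.assoc)
    moreover have "h / (real k + 1) * E k \<le> h / (real k + 1) * (W k - W (k + 1) + \<bar>C2\<bar> / (1 - \<beta>) * z)"
      using EW[OF k] unfolding z_def by (intro mult_left_mono hk)
    moreover have "C1 / (real k + 1)\<^sup>2 \<le> \<bar>C1\<bar> / (real k + 1) * z"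
    proof -
      \<comment> \<open>Since \<open>q \<le> 1\<close>, one of the two factors
        \<open>1 / (k + 1)\<close> may be weakened to \<open>z\<close>.\<close>
      have "1 / (real k + 1) \<le> z" unfolding z_def
        using powr_mono[of q 1 "real k + 1"] q by (intro divide_left_mono) auto
      then have "\<bar>C1\<bar> / (real k + 1) * (1 / (real k + 1)) \<le> \<bar>C1\<bar> / (real k + 1) * z"
        by (intro mult_left_mono) auto
      moreover have "C1 / (real k + 1)\<^sup>2 \<le> \<bar>C1\<bar> / (real k + 1)\<^sup>2" by (intro divide_right_mono) auto
      ultimately show ?thesis by (simp add: power2_eq_square)
    qed
    ultimately have "\<delta> (k + 1) \<le> \<delta> k - (3 / 2) / (real k + 1) * \<delta> k
        + h / (real k + 1) * (W k - W (k + 1) + \<bar>C2\<bar> / (1 - \<beta>) * z) + \<bar>C1\<bar> / (real k + 1) * z"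
      using descent[OF k] by (simp only: right_diff_distrib)
    also have "\<dots> = (1 - (3 / 2) / (real k + 1)) * \<delta> k + h / (real k + 1) * (W k - W (k + 1))
        + (h * \<bar>C2\<bar> / (1 - \<beta>) + \<bar>C1\<bar>) / (real k + 1) * z"
      by (simp add: algebra_simps add_divide_distrib diff_divide_distrib)
    finally show "\<delta> (k + 1) \<le> (1 - (3 / 2) / (real k + 1)) * \<delta> k + h / (real k + 1) * (W k - W (k + 1))
        + (h * \<bar>C2\<bar> / (1 - \<beta>) + \<bar>C1\<bar>) / (real k + 1) * (1 / (real k + 1) powr q)"
      unfolding z_def .
  qed
qed

subsection \<open>Drift of one coordinate\<close>

lemma (in prob_space) integrable_AE_bounded:
  fixes h :: "'a \<Rightarrow> real"
  assumes "h \<in> borel_measurable M" "AE \<omega> in M. \<bar>h \<omega>\<bar> \<le> B"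
  shows "integrable M h"
  by (rule integrable_const_bound[where B = B]) (use assms in auto)

lemma (in sigma_finite_subalgebra) real_cond_exp_abs_le:
  assumes "integrable M h" "AE \<omega> in M. \<bar>h \<omega>\<bar> \<le> c"
  shows "AE \<omega> in M. \<bar>real_cond_exp M F h \<omega>\<bar> \<le> c"
proof -
  have "AE \<omega> in M. - c \<le> real_cond_exp M F h \<omega>"
    by (rule real_cond_exp_ge_c) (use assms in \<open>auto elim!: eventually_mono\<close>)
  moreover have "AE \<omega> in M. real_cond_exp M F h \<omega> \<le> c"
    by (rule real_cond_exp_le_c) (use assms in \<open>auto elim!: eventually_mono\<close>)
  ultimately show ?thesis by eventually_elim auto
qed

text \<open>Here \<open>F\<close> and \<open>F'\<close> are the histories before and after a step, \<open>s'\<close> and \<open>s\<close> the denominators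
  before and after it. Since \<open>s'\<close> need not be \<open>F\<close>-measurable, one divides \<open>u\<close> by its conditional
  expectation given \<open>F\<close> instead. The cost is the squared distance of the conditional expectations of
  \<open>s'\<close> given \<open>F\<close> and given \<open>F'\<close>, which by orthogonality is a difference of second moments.\<close>

lemma (in prob_space) drift_lower_bound:
  fixes u d d' s s' g :: "'a \<Rightarrow> real"
  assumes sub: "subalgebra M F" "subalgebra M F'" "subalgebra F' F"
    and u: "u \<in> borel_measurable F" and d': "d' \<in> borel_measurable F" and d: "d \<in> borel_measurable F'"
    and s: "s \<in> borel_measurable M" and s': "s' \<in> borel_measurable M" and g: "g \<in> borel_measurable M"
    and g_bound: "AE \<omega> in M. \<bar>g \<omega>\<bar> \<le> R" and d_bound: "AE \<omega> in M. \<bar>d \<omega>\<bar> \<le> D" and d'_bound: "AE \<omega> in M. \<bar>d' \<omega>\<bar> \<le> D"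
    and s_bound: "AE \<omega> in M. s \<omega> \<in> {lo..hi}" and s'_bound: "AE \<omega> in M. s' \<omega> \<in> {lo..hi}"
    and lo: "0 < lo" and b: "b \<le> 1" and \<tau>: "0 < \<tau>"
    and close: "AE \<omega> in M. \<bar>s \<omega> - s' \<omega>\<bar> \<le> \<rho>"
    and rec: "AE \<omega> in M. s \<omega> * d \<omega> = b * (s' \<omega> * d' \<omega>) + (1 - b) * g \<omega>"
    and unbiased: "AE \<omega> in M. real_cond_exp M F g \<omega> = u \<omega>"
  defines "\<Delta> \<equiv> expectation (\<lambda>\<omega>. (real_cond_exp M F' s \<omega>)\<^sup>2) - expectation (\<lambda>\<omega>. (real_cond_exp M F s' \<omega>)\<^sup>2) + 2 * hi * \<rho>"
  shows "0 \<le> \<Delta>"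
    and "b * expectation (\<lambda>\<omega>. u \<omega> * d' \<omega>) + ((1 - b) / hi - \<tau>) * expectation (\<lambda>\<omega>. (u \<omega>)\<^sup>2)
        - R / lo * D * \<rho> - D\<^sup>2 / (4 * \<tau> * lo\<^sup>2) * \<Delta> \<le> expectation (\<lambda>\<omega>. u \<omega> * d \<omega>)"
proof -
  interpret F: finite_measure_subalgebra M F by unfold_locales (fact sub)
  interpret F': finite_measure_subalgebra M F' by unfold_locales (fact sub)
  note [measurable] = s s' g
  have [measurable]: "u \<in> borel_measurable M" "d' \<in> borel_measurable M" "d \<in> borel_measurable M"
    using u d d' sub(1,2) measurable_from_subalg by blast+
  have u'[measurable]: "u \<in> borel_measurable F'" using u sub(3) measurable_from_subalg by blast
  \<comment> \<open>\<open>A\<close> and \<open>B\<close> project the old denominator onto the old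
    and the new history. \<open>A'\<close> projects the new denominator onto the new history and so
    plays the part of \<open>A\<close> in the next step; this lets the second moments telescope. The
    quotient \<open>w\<close> satisfies \<open>w * A = u\<close>.\<close>
  define A where "A = real_cond_exp M F s'"
  define B where "B = real_cond_exp M F' s'"
  define A' where "A' = real_cond_exp M F' s"
  define w where "w \<omega> = u \<omega> / A \<omega>" for \<omega>
  have AF[measurable]: "A \<in> borel_measurable F" unfolding A_def by simp
  have [measurable]: "A \<in> borel_measurable F'" "A \<in> borel_measurable M"
    using AF sub(1,3) measurable_from_subalg by blast+
  have BF[measurable]: "B \<in> borel_measurable F'" "A' \<in> borel_measurable F'" unfolding B_def A'_def by simp_all
  have [measurable]: "B \<in> borel_measurable M" "A' \<in> borel_measurable M"
    using BF sub(2) measurable_from_subalg by blast+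
  have wF[measurable]: "w \<in> borel_measurable F" unfolding w_def using u by measurable
  have [measurable]: "w \<in> borel_measurable F'" "w \<in> borel_measurable M"
    using wF sub(1,3) measurable_from_subalg by blast+
  have int_g: "integrable M g" by (rule integrable_AE_bounded) (use g_bound in auto)
  have abs_s: "AE \<omega> in M. \<bar>s \<omega>\<bar> \<le> hi" "AE \<omega> in M. \<bar>s' \<omega>\<bar> \<le> hi" using s_bound s'_bound lo by auto
  have int_s: "integrable M s" "integrable M s'"
    by (rule integrable_AE_bounded, measurable, use abs_s in blast)+
  have A_bound: "AE \<omega> in M. lo \<le> A \<omega>" "AE \<omega> in M. A \<omega> \<le> hi" unfolding A_def
    using F.real_cond_exp_ge_c[OF int_s(2), of lo] F.real_cond_exp_le_c[OF int_s(2), of hi] s'_bound by auto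
  have B_bound: "AE \<omega> in M. lo \<le> B \<omega>" "AE \<omega> in M. B \<omega> \<le> hi" unfolding B_def
    using F'.real_cond_exp_ge_c[OF int_s(2), of lo] F'.real_cond_exp_le_c[OF int_s(2), of hi] s'_bound by auto
  have A'_bound: "AE \<omega> in M. lo \<le> A' \<omega>" "AE \<omega> in M. A' \<omega> \<le> hi" unfolding A'_def
    using F'.real_cond_exp_ge_c[OF int_s(1), of lo] F'.real_cond_exp_le_c[OF int_s(1), of hi] s_bound by auto
  have u_bound: "AE \<omega> in M. \<bar>u \<omega>\<bar> \<le> R"
    using F.real_cond_exp_abs_le[OF int_g g_bound] unbiased by eventually_elim auto
  have w_bound: "AE \<omega> in M. \<bar>w \<omega>\<bar> \<le> R / lo"
    using u_bound A_bound(1) by eventually_elim (auto simp: w_def abs_divide intro!: frac_le lo)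
  \<comment> \<open>An inequality between constants that holds almost surely holds outright on a
    probability space.\<close>
  have "AE \<omega> in M. 0 \<le> R \<and> 0 \<le> D \<and> lo \<le> hi \<and> 0 \<le> \<rho>"
    using g_bound d_bound s_bound close by eventually_elim auto
  then have nonneg: "0 \<le> R" "0 \<le> D" "lo \<le> hi" "0 \<le> \<rho>" by (auto simp: AE_const)
  have Bd: "AE \<omega> in M. \<bar>A' \<omega> - B \<omega>\<bar> \<le> \<rho>"
  proof -
    have i: "integrable M (\<lambda>\<omega>. s \<omega> - s' \<omega>)" using int_s by simp
    from F'.real_cond_exp_abs_le[OF i close] F'.real_cond_exp_diff[OF int_s] show ?thesis
      unfolding A'_def B_def by eventually_elim auto
  qed
  have mult_bound: "AE \<omega> in M. \<bar>h1 \<omega> * h2 \<omega>\<bar> \<le> b1 * b2"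
    if "AE \<omega> in M. \<bar>h1 \<omega>\<bar> \<le> b1" "AE \<omega> in M. \<bar>h2 \<omega>\<bar> \<le> b2" for h1 h2 :: "'a \<Rightarrow> real" and b1 b2
    using that by eventually_elim (auto simp: abs_mult intro!: mult_mono intro: order_trans[OF abs_ge_zero])
  have abs_AB: "AE \<omega> in M. \<bar>A \<omega>\<bar> \<le> hi" "AE \<omega> in M. \<bar>B \<omega>\<bar> \<le> hi" "AE \<omega> in M. \<bar>A' \<omega>\<bar> \<le> hi"
    using A_bound B_bound A'_bound lo by auto
  note bounds = u_bound w_bound abs_s abs_AB g_bound d_bound d'_bound
  have int2: "integrable M (\<lambda>\<omega>. h1 \<omega> * h2 \<omega>)"
    if "AE \<omega> in M. \<bar>h1 \<omega>\<bar> \<le> b1" "AE \<omega> in M. \<bar>h2 \<omega>\<bar> \<le> b2" "h1 \<in> borel_measurable M" "h2 \<in> borel_measurable M"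
    for h1 h2 :: "'a \<Rightarrow> real" and b1 b2
    by (rule integrable_AE_bounded[OF _ mult_bound[OF that(1,2)]]) (use that in measurable)

  have int_sq: "integrable M (\<lambda>\<omega>. A \<omega> * A \<omega>)" "integrable M (\<lambda>\<omega>. B \<omega> * B \<omega>)" "integrable M (\<lambda>\<omega>. A' \<omega> * A' \<omega>)"
    "integrable M (\<lambda>\<omega>. A \<omega> * B \<omega>)" "integrable M (\<lambda>\<omega>. A \<omega> * s' \<omega>)" "integrable M (\<lambda>\<omega>. u \<omega> * u \<omega>)"
    by (rule int2[OF bounds(5,5)] int2[OF bounds(6,6)] int2[OF bounds(7,7)] int2[OF bounds(5,6)]
        int2[OF bounds(5,4)] int2[OF bounds(1,1)]; measurable)+
  \<comment> \<open>\<open>A\<close> is measurable for both histories, so in a product with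
    \<open>A\<close> the factor \<open>s'\<close> may be exchanged for \<open>B\<close> or for
    \<open>A\<close>. Hence \<open>A\<close> and \<open>B - A\<close> are orthogonal, and their
    squared distance is a difference of second moments.\<close>
  have "expectation (\<lambda>\<omega>. A \<omega> * B \<omega>) = expectation (\<lambda>\<omega>. A \<omega> * s' \<omega>)"
    unfolding B_def by (rule F'.real_cond_exp_intg(2)) (use int_sq in auto)
  also have "\<dots> = expectation (\<lambda>\<omega>. A \<omega> * A \<omega>)"
    by (subst (3) A_def, rule F.real_cond_exp_intg(2)[symmetric]) (use int_sq in auto)
  finally have AB: "expectation (\<lambda>\<omega>. A \<omega> * B \<omega>) = expectation (\<lambda>\<omega>. A \<omega> * A \<omega>)" .
  have "expectation (\<lambda>\<omega>. (A \<omega> - B \<omega>)\<^sup>2) = expectation (\<lambda>\<omega>. A \<omega> * A \<omega> + B \<omega> * B \<omega> - 2 * (A \<omega> * B \<omega>))"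
    by (intro Bochner_Integration.integral_cong) (auto simp: power2_eq_square algebra_simps)
  also have "\<dots> = expectation (\<lambda>\<omega>. B \<omega> * B \<omega>) - expectation (\<lambda>\<omega>. A \<omega> * A \<omega>)"
    using int_sq AB by simp
  \<comment> \<open>\<open>B\<close> and \<open>A'\<close> differ by at most \<open>\<rho>\<close>
    and are bounded by \<open>hi\<close>; factoring the difference of their squares gives the term
    \<open>2 * hi * \<rho>\<close> of \<open>\<Delta>\<close>.\<close>
  also have "expectation (\<lambda>\<omega>. B \<omega> * B \<omega>) \<le> expectation (\<lambda>\<omega>. A' \<omega> * A' \<omega> + 2 * hi * \<rho>)"
  proof (rule integral_mono_AE)
    show "AE \<omega> in M. B \<omega> * B \<omega> \<le> A' \<omega> * A' \<omega> + 2 * hi * \<rho>"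
      using Bd abs_AB(2,3)
    proof eventually_elim
      case (elim \<omega>)
      have "(B \<omega> + A' \<omega>) * (B \<omega> - A' \<omega>) \<le> \<bar>B \<omega> + A' \<omega>\<bar> * \<bar>B \<omega> - A' \<omega>\<bar>"
        by (metis abs_ge_self abs_mult)
      also have "\<dots> \<le> (2 * hi) * \<rho>" using elim nonneg lo by (intro mult_mono) auto
      finally show ?case by (simp add: algebra_simps)
    qed
  qed (use int_sq in auto)
  also have "expectation (\<lambda>\<omega>. A' \<omega> * A' \<omega> + 2 * hi * \<rho>) = expectation (\<lambda>\<omega>. A' \<omega> * A' \<omega>) + 2 * hi * \<rho>"
    using int_sq by (simp add: prob_space)
  finally have sq: "expectation (\<lambda>\<omega>. (A \<omega> - B \<omega>)\<^sup>2) \<le> \<Delta>"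
    unfolding \<Delta>_def A_def A'_def by (simp add: power2_eq_square)
  show "0 \<le> \<Delta>" by (rule order_trans[OF _ sq]) simp

  have wd: "AE \<omega> in M. \<bar>w \<omega> * d \<omega>\<bar> \<le> R / lo * D" "AE \<omega> in M. \<bar>w \<omega> * d' \<omega>\<bar> \<le> R / lo * D"
    by (rule mult_bound; fact)+
  have int_w: "integrable M (\<lambda>\<omega>. (w \<omega> * d \<omega>) * B \<omega>)" "integrable M (\<lambda>\<omega>. (w \<omega> * d \<omega>) * A \<omega>)"
    "integrable M (\<lambda>\<omega>. (w \<omega> * d \<omega>) * s \<omega>)" "integrable M (\<lambda>\<omega>. (w \<omega> * d \<omega>) * s' \<omega>)"
    "integrable M (\<lambda>\<omega>. (w \<omega> * d' \<omega>) * s' \<omega>)" "integrable M (\<lambda>\<omega>. w \<omega> * g \<omega>)" "integrable M (\<lambda>\<omega>. w \<omega> * u \<omega>)"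
    "integrable M (\<lambda>\<omega>. (w \<omega> * d \<omega>) * (s \<omega> - s' \<omega>))"
    by (rule int2[OF wd(1) bounds(6)] int2[OF wd(1) bounds(5)] int2[OF wd(1) bounds(3)] int2[OF wd(1) bounds(4)]
       int2[OF wd(2) bounds(4)] int2[OF bounds(2) bounds(8)] int2[OF bounds(2,1)] int2[OF wd(1) close]; measurable)+
  have wA: "AE \<omega> in M. w \<omega> * A \<omega> = u \<omega>"
    using A_bound(1) by eventually_elim (use lo in \<open>auto simp: w_def\<close>)
  \<comment> \<open>The expectation of \<open>w * d * A\<close> is then treated in stages:
    \<open>A\<close> is exchanged for \<open>B\<close> by Young's inequality, \<open>B\<close> for
    \<open>s'\<close> by conditioning on \<open>F'\<close>, \<open>s'\<close> for \<open>s\<close>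
    by closeness, and \<open>rec\<close> rewrites \<open>s * d\<close>.\<close>
  have ud: "expectation (\<lambda>\<omega>. u \<omega> * d \<omega>) = expectation (\<lambda>\<omega>. (w \<omega> * d \<omega>) * A \<omega>)"
    by (rule integral_cong_AE) (use wA in \<open>auto elim!: eventually_mono simp: algebra_simps\<close>)
  \<comment> \<open>The momentum term returns to \<open>u * d'\<close> without error, since
    \<open>w * d'\<close> is \<open>F\<close>-measurable.\<close>
  have ud': "expectation (\<lambda>\<omega>. (w \<omega> * d' \<omega>) * s' \<omega>) = expectation (\<lambda>\<omega>. u \<omega> * d' \<omega>)"
  proof -
    have "expectation (\<lambda>\<omega>. (w \<omega> * d' \<omega>) * s' \<omega>) = expectation (\<lambda>\<omega>. (w \<omega> * d' \<omega>) * A \<omega>)"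
      unfolding A_def by (rule F.real_cond_exp_intg(2)[symmetric]) (use int_w d' in auto)
    also have "\<dots> = expectation (\<lambda>\<omega>. u \<omega> * d' \<omega>)"
      by (rule integral_cong_AE) (use wA in \<open>auto elim!: eventually_mono simp: algebra_simps\<close>)
    finally show ?thesis .
  qed
  have wg: "expectation (\<lambda>\<omega>. w \<omega> * g \<omega>) = expectation (\<lambda>\<omega>. w \<omega> * u \<omega>)"
  proof -
    have "expectation (\<lambda>\<omega>. w \<omega> * g \<omega>) = expectation (\<lambda>\<omega>. w \<omega> * real_cond_exp M F g \<omega>)"
      by (rule F.real_cond_exp_intg(2)[symmetric]) (use int_w in auto)
    also have "\<dots> = expectation (\<lambda>\<omega>. w \<omega> * u \<omega>)"
      by (rule integral_cong_AE) (use unbiased in \<open>auto elim!: eventually_mono\<close>)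
    finally show ?thesis .
  qed
  have wu: "expectation (\<lambda>\<omega>. (u \<omega>)\<^sup>2) / hi \<le> expectation (\<lambda>\<omega>. w \<omega> * u \<omega>)"
  proof -
    have "expectation (\<lambda>\<omega>. u \<omega> * u \<omega> / hi) \<le> expectation (\<lambda>\<omega>. w \<omega> * u \<omega>)"
    proof (rule integral_mono_AE)
      show "AE \<omega> in M. u \<omega> * u \<omega> / hi \<le> w \<omega> * u \<omega>"
        using A_bound by eventually_elim (use lo in \<open>auto simp: w_def intro!: divide_left_mono\<close>)
    qed (use int_sq int_w in auto)
    then show ?thesis by (simp add: power2_eq_square)
  qed
  \<comment> \<open>\<open>d\<close> is known to be measurable only for the new history, so
    \<open>s'\<close> can be exchanged for \<open>B\<close> but not directly for
    \<open>A\<close>.\<close>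
  have Bs: "expectation (\<lambda>\<omega>. (w \<omega> * d \<omega>) * B \<omega>) = expectation (\<lambda>\<omega>. (w \<omega> * d \<omega>) * s' \<omega>)"
    unfolding B_def by (rule F'.real_cond_exp_intg(2)) (use int_w d in auto)
  have "expectation (\<lambda>\<omega>. (w \<omega> * d \<omega>) * (s \<omega> - s' \<omega>)) \<le> expectation (\<lambda>\<omega>. R / lo * D * \<rho>)"
    by (rule integral_mono_AE, fact, simp) (use mult_bound[OF wd(1) close] in \<open>auto elim!: eventually_mono\<close>)
  then have "expectation (\<lambda>\<omega>. (w \<omega> * d \<omega>) * s \<omega>) - expectation (\<lambda>\<omega>. (w \<omega> * d \<omega>) * s' \<omega>) \<le> R / lo * D * \<rho>"
    using int_w by (simp add: right_diff_distrib prob_space)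
  moreover have "expectation (\<lambda>\<omega>. (w \<omega> * d \<omega>) * s \<omega>) = expectation (\<lambda>\<omega>. b * ((w \<omega> * d' \<omega>) * s' \<omega>) + (1 - b) * (w \<omega> * g \<omega>))"
  proof (rule integral_cong_AE)
    show "AE \<omega> in M. w \<omega> * d \<omega> * s \<omega> = b * (w \<omega> * d' \<omega> * s' \<omega>) + (1 - b) * (w \<omega> * g \<omega>)"
      using rec
    proof eventually_elim
      case (elim \<omega>)
      have "w \<omega> * d \<omega> * s \<omega> = w \<omega> * (s \<omega> * d \<omega>)" by simp
      also have "\<dots> = b * (w \<omega> * d' \<omega> * s' \<omega>) + (1 - b) * (w \<omega> * g \<omega>)"
        unfolding elim by (simp add: algebra_simps)
      finally show ?case .
    qed
  qed auto
  moreover have "\<dots> = b * expectation (\<lambda>\<omega>. u \<omega> * d' \<omega>) + (1 - b) * expectation (\<lambda>\<omega>. w \<omega> * u \<omega>)"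
    using int_w ud' wg by simp
  moreover have "(1 - b) * (expectation (\<lambda>\<omega>. (u \<omega>)\<^sup>2) / hi) \<le> (1 - b) * expectation (\<lambda>\<omega>. w \<omega> * u \<omega>)"
    using wu b by (intro mult_left_mono) auto
  moreover have "expectation (\<lambda>\<omega>. (w \<omega> * d \<omega>) * B \<omega>) - expectation (\<lambda>\<omega>. (w \<omega> * d \<omega>) * A \<omega>)
      \<le> \<tau> * expectation (\<lambda>\<omega>. (u \<omega>)\<^sup>2) + D\<^sup>2 / (4 * \<tau> * lo\<^sup>2) * \<Delta>"
  proof -
    have i: "integrable M (\<lambda>\<omega>. (A \<omega> - B \<omega>)\<^sup>2)"
    proof -
      have "integrable M (\<lambda>\<omega>. A \<omega> * A \<omega> + B \<omega> * B \<omega> - 2 * (A \<omega> * B \<omega>))" using int_sq by auto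
      then show ?thesis by (rule Bochner_Integration.integrable_cong[THEN iffD1, rotated 2])
          (auto simp: power2_eq_square algebra_simps)
    qed
    have "expectation (\<lambda>\<omega>. (w \<omega> * d \<omega>) * B \<omega> - (w \<omega> * d \<omega>) * A \<omega>)
        \<le> expectation (\<lambda>\<omega>. \<tau> * (u \<omega> * u \<omega>) + D\<^sup>2 / (4 * \<tau> * lo\<^sup>2) * (A \<omega> - B \<omega>)\<^sup>2)"
    proof (rule integral_mono_AE)
      show "AE \<omega> in M. w \<omega> * d \<omega> * B \<omega> - w \<omega> * d \<omega> * A \<omega>
          \<le> \<tau> * (u \<omega> * u \<omega>) + D\<^sup>2 / (4 * \<tau> * lo\<^sup>2) * (A \<omega> - B \<omega>)\<^sup>2"
        using A_bound(1) d_bound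
      proof eventually_elim
        case (elim \<omega>)
        \<comment> \<open>\<open>y\<close> is the factor of \<open>u\<close> in the error;
          nonnegativity of \<open>(2 * \<tau> * u - y)\<^sup>2\<close> is Young's inequality with
          weight \<open>\<tau>\<close>.\<close>
        define y where "y = d \<omega> * (B \<omega> - A \<omega>) / A \<omega>"
        have "w \<omega> * d \<omega> * B \<omega> - w \<omega> * d \<omega> * A \<omega> = u \<omega> * y"
          by (simp add: w_def y_def right_diff_distrib diff_divide_distrib)
        also have "\<dots> \<le> \<tau> * (u \<omega> * u \<omega>) + y\<^sup>2 / (4 * \<tau>)"
        proof -
          have "0 \<le> (2 * \<tau> * u \<omega> - y)\<^sup>2 / (4 * \<tau>)" using \<tau> by simp
          also have "\<dots> = \<tau> * (u \<omega> * u \<omega>) + y\<^sup>2 / (4 * \<tau>) - u \<omega> * y"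
            using \<tau> by (simp add: power2_eq_square field_simps)
          finally show ?thesis by simp
        qed
        also have "y\<^sup>2 / (4 * \<tau>) \<le> (D\<^sup>2 * (A \<omega> - B \<omega>)\<^sup>2 / lo\<^sup>2) / (4 * \<tau>)"
        proof (intro divide_right_mono)
          have "(d \<omega>)\<^sup>2 \<le> D\<^sup>2" using elim power_mono[of "\<bar>d \<omega>\<bar>" D 2] by simp
          moreover have "lo\<^sup>2 \<le> (A \<omega>)\<^sup>2" using elim lo by (intro power_mono) auto
          ultimately show "y\<^sup>2 \<le> D\<^sup>2 * (A \<omega> - B \<omega>)\<^sup>2 / lo\<^sup>2"
            unfolding y_def power_divide power_mult_distrib power2_commute[of "B \<omega>"]
            using lo by (intro frac_le mult_right_mono mult_nonneg_nonneg) auto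
        qed (use \<tau> in simp)
        finally show ?case by (simp add: field_simps)
      qed
    qed (use i int_sq int_w in auto)
    also have "\<dots> = \<tau> * expectation (\<lambda>\<omega>. (u \<omega>)\<^sup>2) + D\<^sup>2 / (4 * \<tau> * lo\<^sup>2) * expectation (\<lambda>\<omega>. (A \<omega> - B \<omega>)\<^sup>2)"
      using i int_sq by (simp add: power2_eq_square)
    also have "\<dots> \<le> \<tau> * expectation (\<lambda>\<omega>. (u \<omega>)\<^sup>2) + D\<^sup>2 / (4 * \<tau> * lo\<^sup>2) * \<Delta>"
      using sq \<tau> by (intro add_left_mono mult_left_mono) auto
    finally show ?thesis using int_w by simp
  qed
  ultimately show "b * expectation (\<lambda>\<omega>. u \<omega> * d' \<omega>) + ((1 - b) / hi - \<tau>) * expectation (\<lambda>\<omega>. (u \<omega>)\<^sup>2)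
        - R / lo * D * \<rho> - D\<^sup>2 / (4 * \<tau> * lo\<^sup>2) * \<Delta> \<le> expectation (\<lambda>\<omega>. u \<omega> * d \<omega>)"
    using ud Bs by (simp add: left_diff_distrib)
qed

section \<open>The quadratic upper bound for smooth functions\<close>

lemma GDERIV_Lipschitz_upper_bound:
  fixes f :: "'a::real_inner \<Rightarrow> real"
  assumes f: "\<And>y. GDERIV f y :> gradf y"
    and lip: "\<And>y z. norm (gradf y - gradf z) \<le> L * norm (y - z)" and L: "0 \<le> L"
  shows "f z \<le> f y + gradf y \<bullet> (z - y) + L * (norm (z - y))\<^sup>2"
proof -
  define w where "w = z - y"
  have "((\<lambda>t. f (y + t *\<^sub>R w)) has_real_derivative w \<bullet> gradf (y + t *\<^sub>R w)) (at t)" for t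
  proof -
    have "((\<lambda>t. y + t *\<^sub>R w) has_derivative (\<lambda>t. t *\<^sub>R w)) (at t)"
      by (auto intro!: derivative_eq_intros)
    moreover have "(f has_derivative (\<lambda>h. h \<bullet> gradf (y + t *\<^sub>R w))) (at (y + t *\<^sub>R w))"
      using f by (simp add: gderiv_def)
    ultimately have "((\<lambda>t. f (y + t *\<^sub>R w)) has_derivative (\<lambda>s. (s *\<^sub>R w) \<bullet> gradf (y + t *\<^sub>R w))) (at t)"
      by (rule has_derivative_compose)
    then show ?thesis by (simp add: has_field_derivative_def mult_commute_abs)
  qed
  then obtain t :: real where t: "0 < t" "t < 1"
    and mvt: "f (y + 1 *\<^sub>R w) - f (y + 0 *\<^sub>R w) = (1 - 0) * (w \<bullet> gradf (y + t *\<^sub>R w))"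
    using MVT2[of 0 1 "\<lambda>t. f (y + t *\<^sub>R w)" "\<lambda>t. w \<bullet> gradf (y + t *\<^sub>R w)"] by auto
  \<comment> \<open>The mean value point is at distance at most \<open>norm w\<close> from
    \<open>y\<close>. This gives the constant \<open>L\<close> instead of the sharp
    \<open>L / 2\<close>; only the order of the quadratic term matters for the rate.\<close>
  have "w \<bullet> (gradf (y + t *\<^sub>R w) - gradf y) \<le> norm w * (L * norm (t *\<^sub>R w))"
    using lip[of "y + t *\<^sub>R w" y]
    by (intro order_trans[OF norm_cauchy_schwarz] mult_left_mono) auto
  also have "\<dots> = t * (L * (norm w)\<^sup>2)" using t by (simp add: power2_eq_square)
  also have "\<dots> \<le> 1 * (L * (norm w)\<^sup>2)" using t L by (intro mult_right_mono) auto
  finally show ?thesis using mvt by (simp add: w_def inner_diff_right inner_commute)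
qed

section \<open>Measurability of vectors, and the histories\<close>

lemma borel_measurable_vecI:
  fixes h :: "'a \<Rightarrow> real ^ 'n"
  assumes "\<And>i. (\<lambda>\<omega>. h \<omega> $ i) \<in> borel_measurable N"
  shows "h \<in> borel_measurable N"
  by (rule borel_measurable_euclidean_space[THEN iffD2])
    (use assms in \<open>auto simp: Basis_vec_def inner_axis\<close>)

lemma borel_measurable_vec_nth [measurable]:
  fixes h :: "'a \<Rightarrow> real ^ 'n"
  assumes "h \<in> borel_measurable N"
  shows "(\<lambda>\<omega>. h \<omega> $ i) \<in> borel_measurable N"
  by (rule measurable_compose[OF assms borel_measurable_continuous_onI]) (intro continuous_intros)

lemma space_history: "space (history \<Omega> x k) = space \<Omega>"
  unfolding history_def by (rule space_measure_of) auto

lemma sets_history: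
  "sets (history \<Omega> x k) = sigma_sets (space \<Omega>) {x j -` A \<inter> space \<Omega> | j A. j \<in> {1..k} \<and> A \<in> sets borel}"
  unfolding history_def by (rule sets_measure_of) auto

lemma measurable_history:
  fixes x :: "nat \<Rightarrow> 'w \<Rightarrow> 'a::topological_space"
  assumes "j \<in> {1..k}"
  shows "x j \<in> borel_measurable (history \<Omega> x k)"
proof (rule measurableI)
  fix A :: "'a set" assume "A \<in> sets borel"
  with assms show "x j -` A \<inter> space (history \<Omega> x k) \<in> sets (history \<Omega> x k)"
    unfolding space_history sets_history by (intro sigma_sets.Basic) blast
qed simp

lemma subalgebra_history:
  assumes "\<And>j. j \<in> {1..k} \<Longrightarrow> x j \<in> borel_measurable \<Omega>"
  shows "subalgebra \<Omega> (history \<Omega> x k)"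
  unfolding subalgebra_def space_history sets_history
  using measurable_sets[OF assms] by (intro conjI refl sets.sigma_sets_subset) blast

lemma subalgebra_history_Suc: "subalgebra (history \<Omega> x (k + 1)) (history \<Omega> x k)"
  unfolding subalgebra_def space_history sets_history
  by (intro conjI refl sigma_sets_mono') fastforce

subsection \<open>Adam\<close>

locale adam_process = prob_space \<Omega> for \<Omega> :: "'w measure" +
  fixes f :: "real ^ 'n \<Rightarrow> real" and gradf :: "real ^ 'n \<Rightarrow> real ^ 'n"
    and g m v x :: "nat \<Rightarrow> 'w \<Rightarrow> real ^ 'n" and x1 :: "real ^ 'n"
    and \<eta> \<beta>k \<theta> :: "nat \<Rightarrow> real" and \<epsilon> \<beta> M L \<nu> p :: real
  assumes gradient: "GDERIV f y :> gradf y"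
    and eps: "0 < \<epsilon>" and beta: "\<beta> < 1"
    and betak: "1 \<le> k \<Longrightarrow> 0 \<le> \<beta>k k" "1 \<le> k \<Longrightarrow> \<beta>k k \<le> \<beta>"
    and theta: "1 \<le> k \<Longrightarrow> 0 \<le> \<theta> k" "1 \<le> k \<Longrightarrow> \<theta> k < 1"
    and g_measurable: "1 \<le> k \<Longrightarrow> g k \<in> borel_measurable \<Omega>"
    and iterates: "\<omega> \<in> space \<Omega> \<Longrightarrow>
      adam \<eta> \<epsilon> \<beta>k \<theta> x1 (\<lambda>k. g k \<omega>) (\<lambda>k. m k \<omega>) (\<lambda>k. v k \<omega>) (\<lambda>k. x k \<omega>)"
    and unbiased: "1 \<le> k \<Longrightarrow> AE \<omega> in \<Omega>. vec_cond_exp \<Omega> (history \<Omega> x k) (g k) \<omega> = gradf (x k \<omega>)"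
    and M: "0 < M" and g_bounded: "1 \<le> k \<Longrightarrow> AE \<omega> in \<Omega>. norm (g k \<omega>) \<le> M"
    and L: "0 < L" and smooth: "norm (gradf y - gradf z) \<le> L * norm (y - z)"
    and nu: "0 < \<nu>" and PL: "2 * \<nu> * (f y - (INF z. f z)) \<le> (norm (gradf y))\<^sup>2"
    and step_size: "1 \<le> k \<Longrightarrow> \<eta> k = sqrt (M\<^sup>2 + \<epsilon>) / ((1 - \<beta>) * \<nu>) * (1 / (real k + 1))"
    and p: "0 < p" and theta_eq: "1 \<le> k \<Longrightarrow> \<theta> k = 1 - 1 / real k powr p"
begin

section \<open>Notation and pointwise form of the iteration\<close>

abbreviation F :: "nat \<Rightarrow> 'w measure" where "F k \<equiv> history \<Omega> x k"

definition S :: "nat \<Rightarrow> 'n \<Rightarrow> 'w \<Rightarrow> real" where "S k i \<omega> = sqrt (v k \<omega> $ i + \<epsilon>)"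
definition d :: "nat \<Rightarrow> 'w \<Rightarrow> real ^ 'n" where "d k \<omega> = (\<chi> i. m k \<omega> $ i / S k i \<omega>)"
definition U :: "nat \<Rightarrow> 'w \<Rightarrow> real ^ 'n" where "U k \<omega> = gradf (x k \<omega>)"
text \<open>\<open>lo\<close> and \<open>hi\<close> bound every denominator \<open>S k i\<close>,
  \<open>D\<close> bounds every coordinate of the direction \<open>d k\<close>,
  \<open>h / (k + 1)\<close> is the step size, and \<open>\<rho> k\<close> bounds the change of a
  denominator at step \<open>k\<close>.\<close>

definition lo :: real where "lo = sqrt \<epsilon>"
definition hi :: real where "hi = sqrt (M\<^sup>2 + \<epsilon>)"
definition D :: real where "D = M / lo"
definition h :: real where "h = hi / ((1 - \<beta>) * \<nu>)"
definition \<rho> :: "nat \<Rightarrow> real" where "\<rho> k = M\<^sup>2 / lo * (1 / real k powr p)"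

lemma lo_pos: "0 < lo" and hi_pos: "0 < hi" and D_pos: "0 < D" and h_pos: "0 < h"
  unfolding lo_def hi_def D_def h_def using eps M nu beta by (auto simp: add_nonneg_pos)

lemma eta: "1 \<le> k \<Longrightarrow> \<eta> k = h / (real k + 1)"
  using step_size by (simp add: h_def hi_def)

lemma adam_eqs:
  assumes "\<omega> \<in> space \<Omega>"
  shows "m 0 \<omega> = 0" "v 0 \<omega> = 0" "x 1 \<omega> = x1"
    "1 \<le> k \<Longrightarrow> m k \<omega> = \<beta>k k *\<^sub>R m (k - 1) \<omega> + (1 - \<beta>k k) *\<^sub>R g k \<omega>"
    "1 \<le> k \<Longrightarrow> v k \<omega> = \<theta> k *\<^sub>R v (k - 1) \<omega> + (1 - \<theta> k) *\<^sub>R (\<chi> i. (g k \<omega> $ i)\<^sup>2)"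
    "1 \<le> k \<Longrightarrow> x (k + 1) \<omega> = x k \<omega> - \<eta> k *\<^sub>R d k \<omega>"
  using iterates[OF assms] unfolding adam_def d_def S_def by auto

lemma v_nonneg: "\<omega> \<in> space \<Omega> \<Longrightarrow> 0 \<le> v k \<omega> $ i"
proof (induction k)
  case (Suc k)
  then show ?case using adam_eqs(5)[of \<omega> "Suc k"] theta[of "Suc k"] by simp
qed (simp add: adam_eqs)

lemma S_ge: "\<omega> \<in> space \<Omega> \<Longrightarrow> lo \<le> S k i \<omega>"
  unfolding S_def lo_def using v_nonneg by simp

lemma S_d: "\<omega> \<in> space \<Omega> \<Longrightarrow> S k i \<omega> * d k \<omega> $ i = m k \<omega> $ i"
  using S_ge[of \<omega> k i] lo_pos by (simp add: d_def)

lemma d_0: "\<omega> \<in> space \<Omega> \<Longrightarrow> d 0 \<omega> = 0"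
  by (simp add: d_def adam_eqs vec_eq_iff)

section \<open>Measurability of the iterates\<close>

lemma m_measurable [measurable]: "m k \<in> borel_measurable \<Omega>"
proof (induction k)
  case 0
  then show ?case by (subst measurable_cong[where g = "\<lambda>_. 0"]) (auto simp: adam_eqs)
next
  case (Suc k)
  note [measurable] = Suc g_measurable[of "Suc k", simplified]
  show ?case
    by (subst measurable_cong[OF adam_eqs(4)]) (simp_all, measurable)
qed

lemma v_measurable [measurable]: "v k \<in> borel_measurable \<Omega>"
proof (induction k)
  case 0
  then show ?case by (subst measurable_cong[where g = "\<lambda>_. 0"]) (auto simp: adam_eqs)
next
  case (Suc k)
  note [measurable] = Suc g_measurable[of "Suc k", simplified]
  have [measurable]: "(\<lambda>\<omega>. \<chi> i. (g (Suc k) \<omega> $ i)\<^sup>2) \<in> borel_measurable \<Omega>"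
    by (rule borel_measurable_vecI) simp
  show ?case
    by (subst measurable_cong[OF adam_eqs(5)]) (simp_all, measurable)
qed

lemma S_measurable [measurable]: "S k i \<in> borel_measurable \<Omega>"
  unfolding S_def[abs_def] by measurable

lemma d_measurable [measurable]: "d k \<in> borel_measurable \<Omega>"
  unfolding d_def[abs_def] by (rule borel_measurable_vecI) simp

lemma x_measurable: "x (Suc k) \<in> borel_measurable \<Omega>"
proof (induction k)
  case 0
  then show ?case by (subst measurable_cong[where g = "\<lambda>_. x1"]) (use adam_eqs(3) in auto)
next
  case (Suc k)
  note [measurable] = Suc
  show ?case
    by (subst measurable_cong[OF adam_eqs(6)[of _ "Suc k", simplified]]) (simp_all, measurable)
qed

lemma x_measurable' [measurable]: "1 \<le> k \<Longrightarrow> x k \<in> borel_measurable \<Omega>"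
  using x_measurable[of "k - 1"] by simp

lemma sub: "subalgebra \<Omega> (F k)"
  by (rule subalgebra_history) simp

lemma gradf_measurable [measurable]: "gradf \<in> borel_measurable borel"
proof (rule borel_measurable_continuous_onI)
  have "L-lipschitz_on UNIV gradf"
    by (rule lipschitz_onI) (use smooth L in \<open>auto simp: dist_norm\<close>)
  then show "continuous_on UNIV gradf" by (rule lipschitz_on_continuous_on)
qed

lemma f_continuous: "continuous_on UNIV f"
  using gradient by (intro continuous_at_imp_continuous_on) (auto simp: gderiv_def dest: has_derivative_continuous)

lemma f_measurable [measurable]: "f \<in> borel_measurable borel"
  by (rule borel_measurable_continuous_onI[OF f_continuous])

lemma U_measurable_F: "1 \<le> k \<Longrightarrow> U k \<in> borel_measurable (F k)"
  unfolding U_def[abs_def] by (rule measurable_compose[OF measurable_history gradf_measurable]) simp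

text \<open>The history is generated by the iterates alone, but the direction is recovered from two
  consecutive iterates because the step size is a nonzero constant. For \<open>k = 0\<close> it
  vanishes with the initial momentum.\<close>

lemma d_measurable_F: "d k \<in> borel_measurable (F (k + 1))"
proof (cases "k = 0")
  case True
  then show ?thesis by (subst measurable_cong[where g = "\<lambda>_. 0"]) (auto simp: d_0 space_history)
next
  case False
  have [measurable]: "x k \<in> borel_measurable (F (k + 1))" "x (k + 1) \<in> borel_measurable (F (k + 1))"
    by (rule measurable_history; use False in simp)+
  have "d k \<omega> = (1 / \<eta> k) *\<^sub>R (x k \<omega> - x (k + 1) \<omega>)" if "\<omega> \<in> space \<Omega>" for \<omega>
    using adam_eqs(6)[OF that, of k] False eta[of k] h_pos by simp
  then show ?thesis
    by (subst measurable_cong[where g = "\<lambda>\<omega>. (1 / \<eta> k) *\<^sub>R (x k \<omega> - x (k + 1) \<omega>)"])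
      (auto simp: space_history simp del: One_nat_def)
qed

section \<open>Almost sure bounds\<close>

definition good :: "'w \<Rightarrow> bool" where
  "good \<omega> \<longleftrightarrow> \<omega> \<in> space \<Omega> \<and> (\<forall>k\<ge>1. norm (g k \<omega>) \<le> M)"

text \<open>Countably many almost sure bounds hold together on one event; on it the bounds below are
  pointwise inductions.\<close>

lemma AE_good: "AE \<omega> in \<Omega>. good \<omega>"
proof -
  have "AE \<omega> in \<Omega>. \<forall>k. 1 \<le> k \<longrightarrow> norm (g k \<omega>) \<le> M"
    unfolding AE_all_countable using g_bounded by (auto intro: AE_impI)
  then show ?thesis using AE_space by eventually_elim (auto simp: good_def)
qed

lemma good_g: "good \<omega> \<Longrightarrow> 1 \<le> k \<Longrightarrow> \<bar>g k \<omega> $ i\<bar> \<le> M"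
  unfolding good_def using component_le_norm_cart order_trans by blast

text \<open>Each update is a convex combination and the start is 0, so the bound on the gradients is
  inherited; \<open>good_v\<close> repeats this with squares.\<close>

lemma good_m: "good \<omega> \<Longrightarrow> \<bar>m k \<omega> $ i\<bar> \<le> M"
proof (induction k)
  case 0
  then show ?case using M by (simp add: good_def adam_eqs)
next
  case (Suc k)
  have b: "0 \<le> \<beta>k (Suc k)" "\<beta>k (Suc k) \<le> 1" using betak[of "Suc k"] beta by auto
  have "\<bar>m (Suc k) \<omega> $ i\<bar> \<le> \<bar>\<beta>k (Suc k) * m k \<omega> $ i\<bar> + \<bar>(1 - \<beta>k (Suc k)) * g (Suc k) \<omega> $ i\<bar>"
    using Suc.prems adam_eqs(4)[of \<omega> "Suc k"] by (simp add: good_def abs_triangle_ineq)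
  also have "\<dots> \<le> \<beta>k (Suc k) * M + (1 - \<beta>k (Suc k)) * M"
    unfolding abs_mult using b Suc good_g[of \<omega> "Suc k" i] by (intro add_mono mult_mono) auto
  finally show ?case by (simp add: algebra_simps)
qed

lemma good_v: "good \<omega> \<Longrightarrow> v k \<omega> $ i \<le> M\<^sup>2"
proof (induction k)
  case 0
  then show ?case by (simp add: good_def adam_eqs)
next
  case (Suc k)
  have "(g (Suc k) \<omega> $ i)\<^sup>2 \<le> M\<^sup>2"
    using good_g[OF Suc.prems, of "Suc k" i] power_mono[of "\<bar>g (Suc k) \<omega> $ i\<bar>" M 2] by simp
  then have "v (Suc k) \<omega> $ i \<le> \<theta> (Suc k) * M\<^sup>2 + (1 - \<theta> (Suc k)) * M\<^sup>2"
    using Suc adam_eqs(5)[of \<omega> "Suc k"] theta[of "Suc k"]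
    by (auto simp: good_def intro!: add_mono mult_left_mono)
  then show ?case by (simp add: algebra_simps)
qed

lemma good_S: "good \<omega> \<Longrightarrow> S k i \<omega> \<in> {lo..hi}"
  using S_ge[of \<omega> k i] good_v[of \<omega> k i] by (simp add: good_def) (simp add: S_def hi_def)

lemma good_d: "good \<omega> \<Longrightarrow> \<bar>d k \<omega> $ i\<bar> \<le> D"
  using good_m[of \<omega> k i] good_S[of \<omega> k i] lo_pos
  by (auto simp: d_def D_def abs_divide intro!: frac_le)

lemma good_norm_d: "good \<omega> \<Longrightarrow> (norm (d k \<omega>))\<^sup>2 \<le> real CARD('n) * D\<^sup>2"
proof -
  assume "good \<omega>"
  have "(norm (d k \<omega>))\<^sup>2 = (\<Sum>i\<in>UNIV. (d k \<omega> $ i)\<^sup>2)"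
    unfolding power2_norm_eq_inner inner_vec_def by (simp add: power2_eq_square)
  also have "\<dots> \<le> (\<Sum>i\<in>(UNIV::'n set). D\<^sup>2)"
    using good_d[OF \<open>good \<omega>\<close>, of k] power_mono[of "\<bar>d k \<omega> $ _\<bar>" D 2] by (intro sum_mono) fastforce
  finally show ?thesis by simp
qed

text \<open>Since \<open>1 - \<theta> k = 1 / k powr p\<close>, and the squared gradient and the old
  second moment both lie between 0 and \<open>M\<^sup>2\<close>, the radicand moves by at most
  \<open>M\<^sup>2 / k powr p\<close>. Rationalizing the difference of roots divides this by a sum
  that is at least \<open>lo\<close>.\<close>

lemma good_S_diff: "good \<omega> \<Longrightarrow> 1 \<le> k \<Longrightarrow> \<bar>S k i \<omega> - S (k - 1) i \<omega>\<bar> \<le> \<rho> k"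
proof -
  assume \<omega>: "good \<omega>" and k: "1 \<le> k"
  then have \<omega>': "\<omega> \<in> space \<Omega>" by (simp add: good_def)
  define a where "a = v k \<omega> $ i + \<epsilon>"
  define b where "b = v (k - 1) \<omega> $ i + \<epsilon>"
  have ab: "0 < a" "0 < b" unfolding a_def b_def using v_nonneg[OF \<omega>'] eps by (auto simp: add_nonneg_pos)
  have lo: "lo \<le> sqrt a + sqrt b"
    using S_ge[OF \<omega>', of k i] ab unfolding S_def a_def[symmetric] by (simp add: add_increasing2)
  have g2: "(g k \<omega> $ i)\<^sup>2 \<le> M\<^sup>2"
    using good_g[OF \<omega> k, of i] power_mono[of "\<bar>g k \<omega> $ i\<bar>" M 2] by simp
  have "v k \<omega> $ i = (1 - 1 / real k powr p) * v (k - 1) \<omega> $ i + 1 / real k powr p * (g k \<omega> $ i)\<^sup>2"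
    using adam_eqs(5)[OF \<omega>' k] theta_eq[OF k] by simp
  then have "a - b = 1 / real k powr p * ((g k \<omega> $ i)\<^sup>2 - v (k - 1) \<omega> $ i)"
    unfolding a_def b_def by (simp add: algebra_simps)
  then have "\<bar>a - b\<bar> = 1 / real k powr p * \<bar>(g k \<omega> $ i)\<^sup>2 - v (k - 1) \<omega> $ i\<bar>"
    by (simp add: abs_mult)
  also have "\<dots> \<le> 1 / real k powr p * M\<^sup>2"
  proof (intro mult_left_mono)
    have "0 \<le> (g k \<omega> $ i)\<^sup>2" by simp
    then show "\<bar>(g k \<omega> $ i)\<^sup>2 - v (k - 1) \<omega> $ i\<bar> \<le> M\<^sup>2"
      using g2 v_nonneg[OF \<omega>', of "k - 1" i] good_v[OF \<omega>, of "k - 1" i] by linarith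
  qed simp
  finally have diff: "\<bar>a - b\<bar> \<le> 1 / real k powr p * M\<^sup>2" .
  have "\<bar>sqrt a - sqrt b\<bar> * lo \<le> \<bar>sqrt a - sqrt b\<bar> * (sqrt a + sqrt b)"
    using lo by (intro mult_left_mono) auto
  also have "\<dots> = \<bar>(sqrt a - sqrt b) * (sqrt a + sqrt b)\<bar>"
    using ab by (simp add: abs_mult)
  also have "(sqrt a - sqrt b) * (sqrt a + sqrt b) = a - b"
    using ab by (simp add: algebra_simps)
  finally have "\<bar>sqrt a - sqrt b\<bar> * lo \<le> 1 / real k powr p * M\<^sup>2" using diff by linarith
  then have "\<bar>sqrt a - sqrt b\<bar> \<le> (1 / real k powr p * M\<^sup>2) / lo"
    by (rule pos_le_divide_eq[THEN iffD2, OF lo_pos])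
  then show ?thesis
    unfolding S_def a_def[symmetric] b_def[symmetric] \<rho>_def by (simp add: mult.commute)
qed

section \<open>Integrability\<close>

lemma integrable_f: "1 \<le> k \<Longrightarrow> integrable \<Omega> (\<lambda>\<omega>. f (x k \<omega>))"
proof -
  assume k: "1 \<le> k"
  \<comment> \<open>After finitely many bounded steps from a deterministic start, \<open>x k\<close>
    lies in a ball depending only on \<open>k\<close>, and the continuous \<open>f\<close> is
    bounded there.\<close>
  have "\<exists>B. \<forall>\<omega>. good \<omega> \<longrightarrow> norm (x k \<omega>) \<le> B"
    using k
  proof (induction k rule: nat_induct_at_least)
    case base
    then show ?case using adam_eqs(3) by (auto simp: good_def)
  next
    case (Suc k)
    then obtain B where B: "\<And>\<omega>. good \<omega> \<Longrightarrow> norm (x k \<omega>) \<le> B" by blast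
    have "norm (x (Suc k) \<omega>) \<le> B + \<bar>\<eta> k\<bar> * sqrt (real CARD('n) * D\<^sup>2)" if "good \<omega>" for \<omega>
    proof -
      have "norm (x (Suc k) \<omega>) \<le> norm (x k \<omega>) + norm (\<eta> k *\<^sub>R d k \<omega>)"
        using adam_eqs(6)[of \<omega> k] norm_triangle_ineq4[of "x k \<omega>" "\<eta> k *\<^sub>R d k \<omega>"] that Suc.hyps
        by (simp add: good_def)
      also have "\<dots> \<le> B + \<bar>\<eta> k\<bar> * sqrt (real CARD('n) * D\<^sup>2)"
        unfolding norm_scaleR using B[OF that] real_le_rsqrt[OF good_norm_d[OF that]]
        by (intro add_mono mult_left_mono) auto
      finally show ?thesis .
    qed
    then show ?case by blast
  qed
  then obtain B where B: "\<And>\<omega>. good \<omega> \<Longrightarrow> norm (x k \<omega>) \<le> B" by blast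
  have "compact (f ` cball 0 B)"
    by (intro compact_continuous_image continuous_on_subset[OF f_continuous]) auto
  then have "bounded (f ` cball 0 B)" by (rule compact_imp_bounded)
  then obtain C where C: "\<And>y. y \<in> cball 0 B \<Longrightarrow> norm (f y) \<le> C"
    unfolding bounded_iff by blast
  show ?thesis
  proof (rule integrable_AE_bounded)
    show "AE \<omega> in \<Omega>. \<bar>f (x k \<omega>)\<bar> \<le> C"
      using AE_good by eventually_elim (use B C in auto)
  qed (use k in measurable)
qed

lemma unbiased_nth:
  "1 \<le> k \<Longrightarrow> AE \<omega> in \<Omega>. real_cond_exp \<Omega> (F k) (\<lambda>\<omega>. g k \<omega> $ i) \<omega> = U k \<omega> $ i"
  using unbiased[of k] by (auto elim!: eventually_mono simp: vec_cond_exp_def U_def vec_eq_iff)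

lemma U_measurable [measurable]: "1 \<le> k \<Longrightarrow> U k \<in> borel_measurable \<Omega>"
  unfolding U_def[abs_def] by measurable

text \<open>By unbiasedness the true gradient along the iterates is a conditional expectation of the
  stochastic one and inherits its bound.\<close>

lemma U_bounded: "1 \<le> k \<Longrightarrow> AE \<omega> in \<Omega>. \<bar>U k \<omega> $ i\<bar> \<le> M"
proof -
  assume k: "1 \<le> k"
  note [measurable] = g_measurable[OF k]
  interpret Fk: finite_measure_subalgebra \<Omega> "F k" by unfold_locales (rule sub)
  have b: "AE \<omega> in \<Omega>. \<bar>g k \<omega> $ i\<bar> \<le> M"
    using AE_good by eventually_elim (rule good_g[OF _ k])
  have "integrable \<Omega> (\<lambda>\<omega>. g k \<omega> $ i)" by (rule integrable_AE_bounded[OF _ b]) measurable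
  from Fk.real_cond_exp_abs_le[OF this b] unbiased_nth[OF k, of i]
  show ?thesis by eventually_elim auto
qed

lemma integrable_U_d: "1 \<le> k \<Longrightarrow> integrable \<Omega> (\<lambda>\<omega>. U k \<omega> $ i * d l \<omega> $ i)"
  and integrable_U_sq: "1 \<le> k \<Longrightarrow> integrable \<Omega> (\<lambda>\<omega>. (U k \<omega> $ i)\<^sup>2)"
proof -
  assume k: "1 \<le> k"
  show "integrable \<Omega> (\<lambda>\<omega>. U k \<omega> $ i * d l \<omega> $ i)"
  proof (rule integrable_AE_bounded)
    show "AE \<omega> in \<Omega>. \<bar>U k \<omega> $ i * d l \<omega> $ i\<bar> \<le> M * D"
      using U_bounded[OF k, of i] AE_good
      by eventually_elim (use M good_d[of _ l i] in \<open>auto simp: abs_mult intro!: mult_mono\<close>)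
  qed (use k in measurable)
  show "integrable \<Omega> (\<lambda>\<omega>. (U k \<omega> $ i)\<^sup>2)"
  proof (rule integrable_AE_bounded)
    show "AE \<omega> in \<Omega>. \<bar>(U k \<omega> $ i)\<^sup>2\<bar> \<le> M\<^sup>2"
      using U_bounded[OF k, of i] by eventually_elim (metis abs_ge_zero abs_power2 power2_abs power_mono)
  qed (use k in measurable)
qed

section \<open>Averaged drift, projected denominators and error constants\<close>

definition \<mu> :: "nat \<Rightarrow> real" where "\<mu> k = (\<Sum>i\<in>UNIV. expectation (\<lambda>\<omega>. U k \<omega> $ i * d k \<omega> $ i))"
definition G :: "nat \<Rightarrow> real" where "G k = (\<Sum>i\<in>UNIV. expectation (\<lambda>\<omega>. (U k \<omega> $ i)\<^sup>2))"
text \<open>The potential whose increments control the distance between successive projections of a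
  denominator. The index is \<open>k - 1\<close> because step \<open>k\<close> starts from the
  denominator \<open>S (k - 1)\<close>.\<close>

definition a :: "nat \<Rightarrow> real" where
  "a k = (\<Sum>i\<in>UNIV. expectation (\<lambda>\<omega>. (real_cond_exp \<Omega> (F k) (S (k - 1) i) \<omega>)\<^sup>2))"
text \<open>Young's weight is a quarter of \<open>(1 - \<beta>) / hi\<close>, so three quarters of
  the drift survive; with the given step size they become the contraction constant
  \<open>3 / 2\<close>. The resulting coefficient of \<open>\<Delta>\<close> is
  \<open>\<kappa>\<close>.\<close>

definition \<tau> :: real where "\<tau> = (1 - \<beta>) / (4 * hi)"
definition \<kappa> :: real where "\<kappa> = D\<^sup>2 / (4 * \<tau> * lo\<^sup>2)"
definition q :: real where "q = min p 1"
text \<open>The first summand pays for comparing gradients at consecutive iterates. The second pays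
  for both occurrences of \<open>\<rho> k\<close>, in the direct error and inside
  \<open>\<Delta>\<close>; its factor 2 comes from \<open>rho_le\<close>.\<close>

definition C2 :: real where
  "C2 = 2 * L * h * real CARD('n) * D\<^sup>2
     + 2 * real CARD('n) * (M / lo * D + 2 * \<kappa> * hi) * (M\<^sup>2 / lo)"
definition e :: "nat \<Rightarrow> real" where
  "e k = C2 * (1 / (real k + 1) powr q) + \<kappa> * (a (k + 1) - a k)"

lemma q: "0 < q" "q \<le> 1" "q \<le> p" using p by (auto simp: q_def)

lemma tau_pos: "0 < \<tau>" and kappa_nonneg: "0 \<le> \<kappa>"
  unfolding \<tau>_def \<kappa>_def using beta hi_pos by (auto simp: \<tau>_def)

lemma G_nonneg: "0 \<le> G k"
  unfolding G_def by (intro sum_nonneg) simp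

text \<open>Conditional expectation preserves the bound \<open>hi\<close> on the denominators.
  Uniformity in \<open>k\<close> is what makes the telescoping increments harmless.\<close>

lemma a_bounded: "\<bar>a k\<bar> \<le> real CARD('n) * hi\<^sup>2"
proof -
  interpret Fk: finite_measure_subalgebra \<Omega> "F k" by unfold_locales (rule sub)
  have "\<bar>expectation (\<lambda>\<omega>. (real_cond_exp \<Omega> (F k) (S (k - 1) i) \<omega>)\<^sup>2)\<bar> \<le> hi\<^sup>2" for i
  proof -
    have b: "AE \<omega> in \<Omega>. \<bar>S (k - 1) i \<omega>\<bar> \<le> hi"
      using AE_good
    proof eventually_elim
      case (elim \<omega>)
      show ?case using good_S[OF elim, of "k - 1" i] lo_pos by simp
    qed
    have "integrable \<Omega> (S (k - 1) i)" by (rule integrable_AE_bounded[OF _ b]) measurable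
    from Fk.real_cond_exp_abs_le[OF this b]
    have sq: "AE \<omega> in \<Omega>. (real_cond_exp \<Omega> (F k) (S (k - 1) i) \<omega>)\<^sup>2 \<le> hi\<^sup>2"
      by eventually_elim (metis abs_ge_zero power2_abs power_mono)
    have [measurable]: "real_cond_exp \<Omega> (F k) (S (k - 1) i) \<in> borel_measurable \<Omega>"
      by (rule borel_measurable_cond_exp2)
    have "integrable \<Omega> (\<lambda>\<omega>. (real_cond_exp \<Omega> (F k) (S (k - 1) i) \<omega>)\<^sup>2)"
      by (rule integrable_AE_bounded[where B = "hi\<^sup>2"]) (use sq in auto)
    then have "expectation (\<lambda>\<omega>. (real_cond_exp \<Omega> (F k) (S (k - 1) i) \<omega>)\<^sup>2) \<le> expectation (\<lambda>_. hi\<^sup>2)"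
      using sq by (intro integral_mono_AE) auto
    then show ?thesis by (simp add: prob_space)
  qed
  then have "\<bar>a k\<bar> \<le> (\<Sum>i\<in>(UNIV::'n set). hi\<^sup>2)"
    unfolding a_def by (intro order_trans[OF sum_abs] sum_mono)
  then show ?thesis by simp
qed

text \<open>Replacing \<open>p\<close> by \<open>q\<close> weakens the decay, and the shift from
  \<open>k\<close> to \<open>k + 1\<close> costs the factor
  \<open>1 + 1 / k \<le> 2\<close>.\<close>

lemma rho_le: "1 \<le> k \<Longrightarrow> \<rho> k \<le> M\<^sup>2 / lo * (2 * (1 / (real k + 1) powr q))"
proof -
  assume k: "1 \<le> k"
  have "1 / real k powr p \<le> 1 / real k powr q"
    using k q by (intro divide_left_mono powr_mono) auto
  also have "\<dots> \<le> (1 + 1 / real k) * (1 / (real k + 1) powr q)"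
    using Suc_powr_neg_ge[OF q(1,2) k] .
  also have "\<dots> \<le> 2 * (1 / (real k + 1) powr q)"
    using k by (intro mult_right_mono) auto
  finally show ?thesis unfolding \<rho>_def using lo_pos by (intro mult_left_mono) auto
qed

lemma rho_nonneg: "0 \<le> \<rho> k"
  unfolding \<rho>_def using lo_pos by simp

text \<open>The increment \<open>a (k + 1) - a k\<close> pays for the information about \<open>S (k - 1)\<close> that
  \<open>x (k + 1)\<close> reveals.\<close>

definition \<Delta> :: "nat \<Rightarrow> 'n \<Rightarrow> real" where
  "\<Delta> k i = expectation (\<lambda>\<omega>. (real_cond_exp \<Omega> (F (k + 1)) (S k i) \<omega>)\<^sup>2)
    - expectation (\<lambda>\<omega>. (real_cond_exp \<Omega> (F k) (S (k - 1) i) \<omega>)\<^sup>2) + 2 * hi * \<rho> k"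

section \<open>Recursion for the averaged drift\<close>

lemma coordinate_drift:
  assumes k: "1 \<le> k"
  shows "0 \<le> \<Delta> k i"
    and "\<beta>k k * expectation (\<lambda>\<omega>. U k \<omega> $ i * d (k - 1) \<omega> $ i)
        + ((1 - \<beta>k k) / hi - \<tau>) * expectation (\<lambda>\<omega>. (U k \<omega> $ i)\<^sup>2)
        - M / lo * D * \<rho> k - \<kappa> * \<Delta> k i \<le> expectation (\<lambda>\<omega>. U k \<omega> $ i * d k \<omega> $ i)"
proof -
  note [measurable] = g_measurable[OF k]
  \<comment> \<open>The index matters: \<open>d (k - 1)\<close> belongs to the history before step
    \<open>k\<close>, while \<open>d k\<close> belongs only to the one after it.\<close>
  have dF: "(\<lambda>\<omega>. d (k - 1) \<omega> $ i) \<in> borel_measurable (F k)"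
    using d_measurable_F[of "k - 1"] k by (intro borel_measurable_vec_nth) simp
  have UF: "(\<lambda>\<omega>. U k \<omega> $ i) \<in> borel_measurable (F k)"
    and dF': "(\<lambda>\<omega>. d k \<omega> $ i) \<in> borel_measurable (F (k + 1))"
    by (intro borel_measurable_vec_nth U_measurable_F[OF k] d_measurable_F)+
  \<comment> \<open>\<open>S * d = m\<close> at both indices turns the momentum update into the
    linear relation that the drift bound requires.\<close>
  have rec: "AE \<omega> in \<Omega>. S k i \<omega> * d k \<omega> $ i
      = \<beta>k k * (S (k - 1) i \<omega> * d (k - 1) \<omega> $ i) + (1 - \<beta>k k) * g k \<omega> $ i"
    by (rule AE_I2) (simp add: S_d adam_eqs(4)[OF _ k])
  have bnd: "AE \<omega> in \<Omega>. \<bar>g k \<omega> $ i\<bar> \<le> M" "AE \<omega> in \<Omega>. \<bar>d l \<omega> $ i\<bar> \<le> D"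
    "AE \<omega> in \<Omega>. S l i \<omega> \<in> {lo..hi}" "AE \<omega> in \<Omega>. \<bar>S k i \<omega> - S (k - 1) i \<omega>\<bar> \<le> \<rho> k" for l
    using AE_good by (eventually_elim, use good_g k good_d good_S good_S_diff in blast)+
  have "\<beta>k k \<le> 1" using betak(2)[OF k] beta by simp
  note drift = drift_lower_bound[OF sub sub subalgebra_history_Suc UF dF dF' S_measurable S_measurable
      _ bnd(1,2,2,3,3) lo_pos this tau_pos bnd(4) rec unbiased_nth[OF k]]
  show "0 \<le> \<Delta> k i" unfolding \<Delta>_def by (rule drift(1)) measurable
  show "\<beta>k k * expectation (\<lambda>\<omega>. U k \<omega> $ i * d (k - 1) \<omega> $ i)
        + ((1 - \<beta>k k) / hi - \<tau>) * expectation (\<lambda>\<omega>. (U k \<omega> $ i)\<^sup>2)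
        - M / lo * D * \<rho> k - \<kappa> * \<Delta> k i \<le> expectation (\<lambda>\<omega>. U k \<omega> $ i * d k \<omega> $ i)"
    unfolding \<Delta>_def \<kappa>_def by (rule drift(2)) measurable
qed

lemma sum_Delta: "(\<Sum>i\<in>UNIV. \<Delta> k i) = a (k + 1) - a k + real CARD('n) * (2 * hi * \<rho> k)"
  by (simp add: \<Delta>_def a_def sum.distrib sum_subtractf)

text \<open>Consecutive iterates differ by \<open>\<eta> (k - 1)\<close> times the very direction
  \<open>d (k - 1)\<close>, so by smoothness replacing the old gradient by the new one costs at most
  \<open>L * \<eta> (k - 1)\<close> times the squared norm of that direction.\<close>

lemma momentum_transfer:
  assumes k: "1 \<le> k"
  shows "\<mu> (k - 1) - 2 * L * h * real CARD('n) * D\<^sup>2 * (1 / (real k + 1))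
    \<le> (\<Sum>i\<in>UNIV. expectation (\<lambda>\<omega>. U k \<omega> $ i * d (k - 1) \<omega> $ i))"
proof (cases "k = 1")
  \<comment> \<open>For \<open>k = 1\<close> no earlier iterate or step size exists; both sums
    vanish because \<open>d 0 = 0\<close>.\<close>
  case True
  have 0: "expectation (\<lambda>\<omega>. U l \<omega> $ i * d 0 \<omega> $ i) = 0" for i l
    by (rule integral_eq_zero_AE, rule AE_I2) (simp add: d_0)
  have "0 \<le> 2 * L * h * real CARD('n) * D\<^sup>2 * (1 / (real k + 1))"
    using L h_pos by simp
  then show ?thesis using True by (simp add: \<mu>_def 0)
next
  case False
  define j where "j = k - 1"
  have j: "1 \<le> j" "k = j + 1" using k False by (auto simp: j_def)
  have "expectation (\<lambda>\<omega>. \<Sum>i\<in>UNIV. U j \<omega> $ i * d j \<omega> $ i)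
      \<le> expectation (\<lambda>\<omega>. (\<Sum>i\<in>UNIV. U k \<omega> $ i * d j \<omega> $ i) + L * \<eta> j * (real CARD('n) * D\<^sup>2))"
  proof (rule integral_mono_AE)
    show "AE \<omega> in \<Omega>. (\<Sum>i\<in>UNIV. U j \<omega> $ i * d j \<omega> $ i)
        \<le> (\<Sum>i\<in>UNIV. U k \<omega> $ i * d j \<omega> $ i) + L * \<eta> j * (real CARD('n) * D\<^sup>2)"
      using AE_good
    proof eventually_elim
      case (elim \<omega>)
      have eta_pos: "0 \<le> \<eta> j" using eta[OF j(1)] h_pos by simp
      have "(U j \<omega> - U k \<omega>) \<bullet> d j \<omega> \<le> norm (U j \<omega> - U k \<omega>) * norm (d j \<omega>)"
        by (rule norm_cauchy_schwarz)
      also have "\<dots> \<le> (L * norm (\<eta> j *\<^sub>R d j \<omega>)) * norm (d j \<omega>)"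
        using smooth[of "x j \<omega>" "x k \<omega>"] adam_eqs(6)[OF _ j(1), of \<omega>] elim
        by (intro mult_right_mono) (auto simp: U_def j(2) good_def)
      also have "\<dots> = L * \<eta> j * (norm (d j \<omega>))\<^sup>2"
        using eta_pos by (simp add: power2_eq_square)
      also have "\<dots> \<le> L * \<eta> j * (real CARD('n) * D\<^sup>2)"
        using good_norm_d[OF elim] L eta_pos by (intro mult_left_mono) auto
      finally show ?case by (simp add: inner_diff_left) (simp add: inner_vec_def)
    qed
  qed (use integrable_U_d j k in auto)
  then have "\<mu> j \<le> (\<Sum>i\<in>UNIV. expectation (\<lambda>\<omega>. U k \<omega> $ i * d j \<omega> $ i)) + L * \<eta> j * (real CARD('n) * D\<^sup>2)"
    unfolding \<mu>_def using integrable_U_d j k by (simp add: prob_space)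
  moreover have "L * \<eta> j * (real CARD('n) * D\<^sup>2) \<le> 2 * L * h * real CARD('n) * D\<^sup>2 * (1 / (real k + 1))"
  proof -
    \<comment> \<open>The previous step size is \<open>h / k\<close>, and
      \<open>k + 1 \<le> 2 * k\<close>.\<close>
    have "\<eta> j \<le> 2 * h * (1 / (real k + 1))"
      unfolding eta[OF j(1)] using j h_pos by (simp add: divide_simps)
    then have "(L * (real CARD('n) * D\<^sup>2)) * \<eta> j \<le> (L * (real CARD('n) * D\<^sup>2)) * (2 * h * (1 / (real k + 1)))"
      using L by (intro mult_left_mono) auto
    then show ?thesis by (simp add: ac_simps)
  qed
  ultimately show ?thesis unfolding j_def by linarith
qed

text \<open>The coordinate drifts are summed, \<open>momentum_transfer\<close> restores
  \<open>\<mu> (k - 1)\<close>, and the three errors (gradient transfer, change of denominators,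
  projection) are collected in \<open>e k\<close>.\<close>

lemma momentum_step:
  assumes k: "1 \<le> k"
  shows "\<beta>k k * \<mu> (k - 1) + 3 * (1 - \<beta>) / (4 * hi) * G k - e k \<le> \<mu> k" and "0 \<le> e k"
proof -
  define N where "N = real CARD('n)"
  define z where "z = 1 / (real k + 1) powr q"
  define y where "y = 2 * L * h * N * D\<^sup>2"
  have y: "0 \<le> y" unfolding y_def N_def using L h_pos by simp
  have r: "1 / (real k + 1) \<le> z"
    unfolding z_def using powr_mono[of q 1 "real k + 1"] q by (intro divide_left_mono) auto
  have w: "0 \<le> N * (M / lo * D + 2 * \<kappa> * hi)"
    unfolding N_def using M lo_pos D_pos kappa_nonneg hi_pos by simp
  have e: "y * (1 / (real k + 1)) + N * (M / lo * D * \<rho> k) + \<kappa> * (\<Sum>i\<in>UNIV. \<Delta> k i) \<le> e k"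
  proof -
    have "y * (1 / (real k + 1)) \<le> y * z" using r y by (intro mult_left_mono)
    moreover have "N * (M / lo * D + 2 * \<kappa> * hi) * \<rho> k \<le> N * (M / lo * D + 2 * \<kappa> * hi) * (M\<^sup>2 / lo * (2 * z))"
      using rho_le[OF k] w unfolding z_def by (intro mult_left_mono)
    moreover have "e k = y * z + N * (M / lo * D + 2 * \<kappa> * hi) * (M\<^sup>2 / lo * (2 * z)) + \<kappa> * (a (k + 1) - a k)"
      unfolding e_def C2_def z_def[symmetric] y_def N_def by (simp add: algebra_simps)
    moreover have "N * (M / lo * D * \<rho> k) + \<kappa> * (\<Sum>i\<in>UNIV. \<Delta> k i)
        = N * (M / lo * D + 2 * \<kappa> * hi) * \<rho> k + \<kappa> * (a (k + 1) - a k)"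
      unfolding sum_Delta N_def by (simp add: algebra_simps)
    ultimately show ?thesis by linarith
  qed
  \<comment> \<open>The increment of \<open>a\<close> may be negative, but \<open>e k\<close>
    dominates a sum of three nonnegative errors.\<close>
  have "0 \<le> \<kappa> * (\<Sum>i\<in>UNIV. \<Delta> k i)"
    using coordinate_drift(1)[OF k] kappa_nonneg by (intro mult_nonneg_nonneg sum_nonneg) auto
  moreover have "0 \<le> N * (M / lo * D * \<rho> k)" "0 \<le> y * (1 / (real k + 1))"
    using M lo_pos D_pos rho_nonneg y by (auto simp: N_def)
  ultimately show "0 \<le> e k" using e by linarith
  have b: "0 \<le> \<beta>k k" "\<beta>k k \<le> \<beta>" "\<beta>k k \<le> 1" using betak[OF k] beta by auto
  define T where "T = (\<Sum>i\<in>UNIV. expectation (\<lambda>\<omega>. U k \<omega> $ i * d (k - 1) \<omega> $ i))"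
  have "(\<Sum>i\<in>UNIV. \<beta>k k * expectation (\<lambda>\<omega>. U k \<omega> $ i * d (k - 1) \<omega> $ i)
        + ((1 - \<beta>k k) / hi - \<tau>) * expectation (\<lambda>\<omega>. (U k \<omega> $ i)\<^sup>2)
        - M / lo * D * \<rho> k - \<kappa> * \<Delta> k i) \<le> \<mu> k"
    unfolding \<mu>_def by (intro sum_mono coordinate_drift(2)[OF k])
  then have "\<beta>k k * T + ((1 - \<beta>k k) / hi - \<tau>) * G k
      - N * (M / lo * D * \<rho> k) - \<kappa> * (\<Sum>i\<in>UNIV. \<Delta> k i) \<le> \<mu> k"
    unfolding T_def G_def N_def by (simp add: sum.distrib sum_subtractf sum_distrib_left)
  \<comment> \<open>\<open>\<beta>k k \<le> \<beta>\<close> leaves at least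
    \<open>(1 - \<beta>) / hi\<close>, of which \<open>\<tau>\<close> removes a quarter.\<close>
  moreover have "3 * (1 - \<beta>) / (4 * hi) * G k \<le> ((1 - \<beta>k k) / hi - \<tau>) * G k"
  proof (intro mult_right_mono G_nonneg)
    have "(1 - \<beta>) / hi \<le> (1 - \<beta>k k) / hi" using b hi_pos by (intro divide_right_mono) auto
    then show "3 * (1 - \<beta>) / (4 * hi) \<le> (1 - \<beta>k k) / hi - \<tau>"
      unfolding \<tau>_def using hi_pos by (simp add: field_simps)
  qed
  moreover have "\<beta>k k * \<mu> (k - 1) - y * (1 / (real k + 1)) \<le> \<beta>k k * T"
  proof -
    have "\<beta>k k * (\<mu> (k - 1) - y * (1 / (real k + 1))) \<le> \<beta>k k * T"
      using momentum_transfer[OF k] b unfolding T_def y_def N_def by (intro mult_left_mono)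
    moreover have "\<beta>k k * (y * (1 / (real k + 1))) \<le> 1 * (y * (1 / (real k + 1)))"
      using b y by (intro mult_right_mono) auto
    ultimately show ?thesis by (simp add: right_diff_distrib)
  qed
  ultimately show "\<beta>k k * \<mu> (k - 1) + 3 * (1 - \<beta>) / (4 * hi) * G k - e k \<le> \<mu> k"
    using e by linarith
qed

section \<open>Decay of the expected function gap\<close>

definition gap :: "nat \<Rightarrow> real" where "gap k = expectation (\<lambda>\<omega>. f (x k \<omega>)) - (INF y. f y)"

text \<open>The smoothness inequality along one step, averaged. The direction is bounded almost
  surely by a constant, so the quadratic term is of the order of the squared step size.\<close>

lemma gap_step:
  assumes k: "1 \<le> k"
  shows "gap (k + 1) \<le> gap k - h / (real k + 1) * \<mu> k + (L * h\<^sup>2 * (real CARD('n) * D\<^sup>2)) / (real k + 1)\<^sup>2"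
proof -
  define B where "B = (L * h\<^sup>2 * (real CARD('n) * D\<^sup>2)) / (real k + 1)\<^sup>2"
  have "expectation (\<lambda>\<omega>. f (x (k + 1) \<omega>))
      \<le> expectation (\<lambda>\<omega>. f (x k \<omega>) - h / (real k + 1) * (\<Sum>i\<in>UNIV. U k \<omega> $ i * d k \<omega> $ i) + B)"
  proof (rule integral_mono_AE)
    show "AE \<omega> in \<Omega>. f (x (k + 1) \<omega>)
        \<le> f (x k \<omega>) - h / (real k + 1) * (\<Sum>i\<in>UNIV. U k \<omega> $ i * d k \<omega> $ i) + B"
      using AE_good
    proof eventually_elim
      case (elim \<omega>)
      have step: "x (k + 1) \<omega> - x k \<omega> = - (\<eta> k *\<^sub>R d k \<omega>)"
        using adam_eqs(6)[OF _ k] elim by (simp add: good_def)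
      have "f (x (k + 1) \<omega>) \<le> f (x k \<omega>) + U k \<omega> \<bullet> (x (k + 1) \<omega> - x k \<omega>) + L * (norm (x (k + 1) \<omega> - x k \<omega>))\<^sup>2"
        unfolding U_def using gradient smooth L by (intro GDERIV_Lipschitz_upper_bound) auto
      also have "L * (norm (x (k + 1) \<omega> - x k \<omega>))\<^sup>2 = (L * (\<eta> k)\<^sup>2) * (norm (d k \<omega>))\<^sup>2"
        unfolding step by (simp add: power_mult_distrib)
      also have "\<dots> \<le> (L * (\<eta> k)\<^sup>2) * (real CARD('n) * D\<^sup>2)"
        using good_norm_d[OF elim] L by (intro mult_left_mono) auto
      also have "\<dots> = B" unfolding B_def eta[OF k] by (simp add: power_divide)
      also have "U k \<omega> \<bullet> (x (k + 1) \<omega> - x k \<omega>) = - (h / (real k + 1) * (\<Sum>i\<in>UNIV. U k \<omega> $ i * d k \<omega> $ i))"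
        unfolding step eta[OF k] inner_minus_right inner_scaleR_right by (simp add: inner_vec_def)
      finally show ?case by simp
    qed
  qed (use integrable_f[of k] integrable_f[of "k + 1"] integrable_U_d k in auto)
  also have "\<dots> = expectation (\<lambda>\<omega>. f (x k \<omega>)) - h / (real k + 1) * \<mu> k + B"
    unfolding \<mu>_def using integrable_f[OF k] integrable_U_d[OF k] by (simp add: prob_space)
  finally show ?thesis unfolding gap_def B_def by simp
qed

text \<open>Here the prescribed step size enters: \<open>h * (3 * (1 - \<beta>) / (4 * hi))\<close>
  collapses to \<open>3 / (4 * \<nu>)\<close>, which the averaged Polyak-Lojasiewicz inequality
  turns into the factor \<open>3 / 2\<close>. That it exceeds 1 is what permits the rate
  \<open>1 / k\<close>.\<close>

lemma PL_gap:
  assumes k: "1 \<le> k"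
  shows "3 / 2 * gap k \<le> h * (3 * (1 - \<beta>) / (4 * hi)) * G k"
proof -
  have "expectation (\<lambda>\<omega>. 2 * \<nu> * (f (x k \<omega>) - (INF z. f z))) \<le> expectation (\<lambda>\<omega>. \<Sum>i\<in>UNIV. (U k \<omega> $ i)\<^sup>2)"
  proof (rule integral_mono)
    show "2 * \<nu> * (f (x k \<omega>) - (INF z. f z)) \<le> (\<Sum>i\<in>UNIV. (U k \<omega> $ i)\<^sup>2)" for \<omega>
      using PL[of "x k \<omega>"] unfolding power2_norm_eq_inner inner_vec_def U_def
      by (simp add: power2_eq_square)
  qed (use integrable_f[OF k] integrable_U_sq[OF k] in auto)
  then have "2 * \<nu> * gap k \<le> G k"
    unfolding gap_def G_def using integrable_f[OF k] integrable_U_sq[OF k] by (simp add: prob_space)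
  then have "3 / (4 * \<nu>) * (2 * \<nu> * gap k) \<le> 3 / (4 * \<nu>) * G k"
    using nu by (intro mult_left_mono) auto
  moreover have "h * (3 * (1 - \<beta>) / (4 * hi)) = 3 / (4 * \<nu>)"
    unfolding h_def using hi_pos beta nu by (simp add: field_simps)
  ultimately show ?thesis using nu by simp
qed

lemma gap_rate: "\<exists>C\<ge>0. \<forall>k\<ge>1. gap k \<le> C / real k powr q"
proof (rule momentum_recursion_rate[where b = \<beta>k and \<beta> = \<beta> and h = h and c = "3 * (1 - \<beta>) / (4 * hi)"
      and G = G and \<mu> = \<mu> and e = e and a = a and ?C2.0 = C2 and ?C3.0 = \<kappa>
      and ?C1.0 = "L * h\<^sup>2 * (real CARD('n) * D\<^sup>2)"])
  show "0 \<le> h" using h_pos by simp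
  show "e k = C2 * (1 / (real k + 1) powr q) + \<kappa> * (a (k + 1) - a k)" for k by (fact e_def)
  show "\<bar>a k\<bar> \<le> real CARD('n) * hi\<^sup>2" for k by (fact a_bounded)
  show "0 \<le> 3 * (1 - \<beta>) / (4 * hi)" using beta hi_pos by simp
  show "\<mu> 0 = 0"
    unfolding \<mu>_def by (intro sum.neutral ballI integral_eq_zero_AE AE_I2) (simp add: d_0)
qed (fact q(1) q(2) betak beta G_nonneg gap_step momentum_step PL_gap)+

end

section \<open>The rate in the three ranges of \<open>p\<close>\<close>

theorem corollary14:
  fixes \<Omega> :: "'w measure" and P :: "'z measure"
    and \<xi> :: "nat \<Rightarrow> 'w \<Rightarrow> 'z"
    and loss :: "real ^ 'n \<Rightarrow> 'z \<Rightarrow> real"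
    and f :: "real ^ 'n \<Rightarrow> real" and gradf :: "real ^ 'n \<Rightarrow> real ^ 'n"
    and g m v x :: "nat \<Rightarrow> 'w \<Rightarrow> real ^ 'n" and x1 :: "real ^ 'n"
    and \<eta> \<beta>k \<theta> :: "nat \<Rightarrow> real"
    and \<epsilon> \<beta> M L \<nu> p :: real
  assumes "prob_space \<Omega>" and "prob_space P"
    and data: "\<forall>k\<ge>1. \<xi> k \<in> measurable \<Omega> P \<and> distr \<Omega> P (\<xi> k) = P"
    and objective: "\<forall>y. integrable P (loss y) \<and> f y = (LINT z|P. loss y z)"
    and gradient: "\<forall>y. GDERIV f y :> gradf y"
    and params: "\<epsilon> > 0" "\<beta> < 1"
      "\<forall>k\<ge>1. \<eta> k > 0" "\<forall>k\<ge>1. 0 \<le> \<beta>k k \<and> \<beta>k k \<le> \<beta>" "\<forall>k\<ge>1. 0 \<le> \<theta> k \<and> \<theta> k < 1"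
    and sampled_gradient: "\<forall>k\<ge>1. g k \<in> borel_measurable \<Omega>"
      "\<forall>k\<ge>1. \<forall>\<omega>\<in>space \<Omega>. GDERIV (\<lambda>y. loss y (\<xi> k \<omega>)) (x k \<omega>) :> g k \<omega>"
    and iterates: "\<forall>\<omega>\<in>space \<Omega>.
      adam \<eta> \<epsilon> \<beta>k \<theta> x1 (\<lambda>k. g k \<omega>) (\<lambda>k. m k \<omega>) (\<lambda>k. v k \<omega>) (\<lambda>k. x k \<omega>)"
    and unbiased: "\<forall>k\<ge>1. AE \<omega> in \<Omega>. vec_cond_exp \<Omega> (history \<Omega> x k) (g k) \<omega> = gradf (x k \<omega>)"
    and bounded_gradient: "M > 0" "\<forall>k\<ge>1. AE \<omega> in \<Omega>. norm (g k \<omega>) \<le> M"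
    and bounded_below: "bdd_below (range f)"
    and smooth: "L > 0" "\<forall>y z. norm (gradf y - gradf z) \<le> L * norm (y - z)"
    and PL: "\<nu> > 0" "\<forall>y. (norm (gradf y))\<^sup>2 \<ge> 2 * \<nu> * (f y - (INF z. f z))"
    and step_size: "\<forall>k\<ge>1. \<eta> k = sqrt (M\<^sup>2 + \<epsilon>) / ((1 - \<beta>) * \<nu>) * (1 / (real k + 1))"
    and second_moment: "p > 0" "\<forall>k\<ge>1. \<theta> k = 1 - 1 / real k powr p"
  shows "\<exists>r1 r2.
    r1 \<in> O(\<lambda>K. 1 / real K) \<and>
    r2 \<in> O(\<lambda>K. if p < 2 then 1 / real K powr p
                else if p = 2 then ln (real K) / (real K)\<^sup>2
                else 1 / (real K)\<^sup>2) \<and>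
    (\<forall>K\<ge>1. (LINT \<omega>|\<Omega>. f (x (K + 1) \<omega>)) - (INF y. f y) \<le> r1 K + r2 K)"
proof -
  interpret A: adam_process \<Omega> f gradf g m v x x1 \<eta> \<beta>k \<theta> \<epsilon> \<beta> M L \<nu> p
    by (intro adam_process.intro adam_process_axioms.intro) (use assms in auto)
  obtain C where C: "0 \<le> C" "\<And>k. 1 \<le> k \<Longrightarrow> A.gap k \<le> C / real k powr A.q"
    using A.gap_rate by blast
  have rate: "(LINT \<omega>|\<Omega>. f (x (K + 1) \<omega>)) - (INF y. f y) \<le> C * (1 / real K powr min p 1)" if K: "1 \<le> K" for K
  proof -
    have "C / real (K + 1) powr A.q \<le> C / real K powr A.q"
      using K C A.q by (intro divide_left_mono powr_mono2) auto
    then show ?thesis using C(2)[of "K + 1"] unfolding A.gap_def A.q_def by simp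
  qed
  show ?thesis
  \<comment> \<open>Only the exponent \<open>min p 1\<close> matters. For \<open>p < 1\<close> the
    whole bound goes into \<open>r2\<close>, whose case is then \<open>1 / K powr p\<close>; for
    \<open>p \<ge> 1\<close> it goes into \<open>r1\<close>, and \<open>r2 = 0\<close> serves all
    three cases.\<close>
  proof (cases "p < 1")
    case True
    show ?thesis
    proof (intro exI conjI allI impI)
      show "(\<lambda>K. 0) \<in> O(\<lambda>K. 1 / real K)" by simp
      show "(\<lambda>K. C * (1 / real K powr p)) \<in> O(\<lambda>K. if p < 2 then 1 / real K powr p
                else if p = 2 then ln (real K) / (real K)\<^sup>2
                else 1 / (real K)\<^sup>2)"
        using True by (intro bigoI[where c = C]) (simp add: abs_mult C(1))
      show "(LINT \<omega>|\<Omega>. f (x (K + 1) \<omega>)) - (INF y. f y) \<le> 0 + C * (1 / real K powr p)" if "1 \<le> K" for K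
        using rate[OF that] True by simp
    qed
  next
    case False
    show ?thesis
    proof (intro exI conjI allI impI)
      show "(\<lambda>K. C * (1 / real K)) \<in> O(\<lambda>K. 1 / real K)"
        by (intro bigoI[where c = C]) (simp add: abs_mult C(1))
      show "(\<lambda>K. 0) \<in> O(\<lambda>K. if p < 2 then 1 / real K powr p
                else if p = 2 then ln (real K) / (real K)\<^sup>2
                else 1 / (real K)\<^sup>2)" by simp
      show "(LINT \<omega>|\<Omega>. f (x (K + 1) \<omega>)) - (INF y. f y) \<le> C * (1 / real K) + 0" if "1 \<le> K" for K
        using rate[OF that] that False by simp
    qed
  qed
qed

end
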